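(* Let $\Omega\subset\mathbb{R}^2$ be a bounded open set with $\mathrm{diam}(\Omega)\le 1$. Then, for any polarizer $H$, $$\tau_1(\Omega)\le \tau_1(P_H(\Omega)).$$ Furthermore, equality holds only if $P_H(\Omega)\cong\Omega$ or $P_H(\Omega)\cong\sigma_H(\Omega)$.
   Context: For a bounded open set $\Omega\subset\mathbb{R}^2$, the Logarithmic potential operator $\mathcal{L}$ on $L^2(\Omega)$ (real-valued functions) is $\mathcal{L}u(x)=\frac{1}{2\pi}\int_\Omega \log\frac{1}{|x-y|}\,u(y)\,dy$; it is self-adjoint and compact. Its largest eigenvalue is denoted $\tau_1(\Omega)$ and satisfies $\tau_1(\Omega)=\sup\{E(u):u\in L^2(\Omega),\ \|u\|_{L^2(\Omega)}=1\}$, where $E(u)=\frac{1}{2\pi}\int_\Omega\int_\Omega\log\frac{1}{|x-y|}u(x)u(y)\,dx\,dy$. A polarizer $H$ is an open affine half-space of $\mathbb{R}^N$ (here $N=2$); $\sigma_H$ denotes the reflection with respect to the boundary $\partial H$. For $\Omega\subset\mathbb{R}^N$, the polarization of $\Omega$ with respect to $H$ is $P_H(\Omega)=[(\Omega\cup\sigma_H(\Omega))\cap H]\cup[\Omega\cap\sigma_H(\Omega)]$. For measurable sets $A,B$, $A\cong B$ means $|A\triangle B|=0$, where $\triangle$ is the symmetric difference and $|\cdot|$ is Lebesgue measure. $\mathrm{diam}(\Omega)=\sup_{x,y\in\Omega}|x-y|$. *)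

theory Defs
  imports "HOL-Analysis.Analysis"
begin

definition polarizer :: "'a::euclidean_space set \<Rightarrow> bool" where
  "polarizer H \<longleftrightarrow> (\<exists>a b. a \<noteq> 0 \<and> H = {x. a \<bullet> x < b})"

text \<open>For an open half-space \<open>H\<close> the frontier is a hyperplane, and \<open>closest_point (frontier H)\<close>
  is the orthogonal projection onto it; the closed formula is \<open>reflection_halfspace\<close> below.\<close>

definition reflection :: "'a::euclidean_space set \<Rightarrow> 'a \<Rightarrow> 'a" where
  "reflection H x = 2 *\<^sub>R closest_point (frontier H) x - x"

lemma reflection_halfspace:
  fixes a x :: "'a::euclidean_space"
  assumes "a \<noteq> 0"
  shows "reflection {x. a \<bullet> x < b} x = x - (2 * (a \<bullet> x - b) / (a \<bullet> a)) *\<^sub>R a"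
proof -
  define p where "p = x - ((a \<bullet> x - b) / (a \<bullet> a)) *\<^sub>R a"
  have p: "a \<bullet> p = b"
    using assms by (simp add: p_def inner_diff_right)
  have "p = closest_point {x. a \<bullet> x = b} x"
  proof (rule closest_point_unique)
    show "\<forall>z\<in>{x. a \<bullet> x = b}. dist x p \<le> dist x z"
    proof
      fix z assume "z \<in> {x. a \<bullet> x = b}"
      then have z: "a \<bullet> z = b" by simp
      have "x - p = ((a \<bullet> x - b) / (a \<bullet> a)) *\<^sub>R a" by (simp add: p_def)
      then have "orthogonal (x - p) (p - z)"
        by (simp add: orthogonal_def inner_diff_right p z)
      then have "(norm (x - p + (p - z)))\<^sup>2 = (norm (x - p))\<^sup>2 + (norm (p - z))\<^sup>2"
        by (rule norm_add_Pythagorean)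
      then have "(norm (x - p))\<^sup>2 \<le> (norm (x - z))\<^sup>2" by simp
      then show "dist x p \<le> dist x z" by (simp add: dist_norm)
    qed
  qed (use p in \<open>simp_all add: convex_hyperplane closed_hyperplane\<close>)
  then have "reflection {x. a \<bullet> x < b} x = 2 *\<^sub>R p - x"
    using assms by (simp add: reflection_def frontier_halfspace_lt)
  also have "\<dots> = x - (2 * ((a \<bullet> x - b) / (a \<bullet> a))) *\<^sub>R a"
    by (simp add: p_def scaleR_2 scaleR_right_diff_distrib)
  finally show ?thesis by simp
qed

definition polarization :: "'a::euclidean_space set \<Rightarrow> 'a set \<Rightarrow> 'a set" where
  "polarization H \<Omega> = ((\<Omega> \<union> reflection H ` \<Omega>) \<inter> H) \<union> (\<Omega> \<inter> reflection H ` \<Omega>)"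

definition ae_eq_set :: "'a::euclidean_space set \<Rightarrow> 'a set \<Rightarrow> bool"  (infix \<open>\<cong>\<^sub>a\<^sub>e\<close> 50) where
  "A \<cong>\<^sub>a\<^sub>e B \<longleftrightarrow> sym_diff A B \<in> null_sets lebesgue"

text \<open>Elements of \<open>L\<^sup>2(\<Omega>)\<close> are represented by functions, with equality in \<open>L\<^sup>2(\<Omega>)\<close>
  being equality almost everywhere in \<open>\<Omega>\<close>.\<close>

definition in_L2 :: "'a::euclidean_space set \<Rightarrow> ('a \<Rightarrow> real) \<Rightarrow> bool" where
  "in_L2 \<Omega> u \<longleftrightarrow>
     u \<in> borel_measurable (lebesgue_on \<Omega>) \<and> integrable (lebesgue_on \<Omega>) (\<lambda>x. (u x)\<^sup>2)"

definition log_potential :: "(real^2) set \<Rightarrow> (real^2 \<Rightarrow> real) \<Rightarrow> real^2 \<Rightarrow> real" where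
  "log_potential \<Omega> u x =
     1 / (2 * pi) * (LINT y|lebesgue_on \<Omega>. ln (1 / norm (x - y)) * u y)"

definition log_potential_eigenvalue :: "(real^2) set \<Rightarrow> real \<Rightarrow> bool" where
  "log_potential_eigenvalue \<Omega> t \<longleftrightarrow>
     (\<exists>u. in_L2 \<Omega> u \<and> \<not> (AE x in lebesgue_on \<Omega>. u x = 0) \<and>
          (AE x in lebesgue_on \<Omega>. log_potential \<Omega> u x = t * u x))"

text \<open>The value is unspecified when no largest eigenvalue exists, as for \<open>\<Omega> = {}\<close>.\<close>

definition tau1 :: "(real^2) set \<Rightarrow> real" where
  "tau1 \<Omega> = (GREATEST t. log_potential_eigenvalue \<Omega> t)"

end

theory Submission
  imports Defs "HOL-Complex_Analysis.Great_Picard"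
begin

text \<open>The logarithmic potential operator on a set of diameter at most one has the nonnegative
kernel \<open>log (1 / |x - y|) / (2 \<pi>)\<close>, and its largest eigenvalue is the maximum of the
Rayleigh quotient \<open>E(u) / \<parallel>u\<parallel>\<^sup>2\<close>. Take an eigenfunction \<open>w\<close> for \<open>\<tau>\<^sub>1(\<Omega>)\<close>. It can be chosen
positive on \<open>\<Omega>\<close>, since replacing a function by its absolute value does not decrease the
energy. Extend it by zero and polarize it: at every pair of mirror points \<open>x, \<sigma> x\<close>, give the
larger of the two values to the point in \<open>H\<close>. The polarized function lives on the polarized
set, has the same norm, and has at least the same energy, so it is a competitor which shows
\<open>\<tau>\<^sub>1(\<Omega>) \<le> \<tau>\<^sub>1(P\<^sub>H(\<Omega>))\<close>.

The energy inequality is a rearrangement inequality for two points. Reflecting \<open>x\<close> or \<open>y\<close> or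
both preserves the double integral \<open>E(u)\<close>, so \<open>4 E(u)\<close> is the integral of a density
(\<open>reflected_energy_density\<close>) that involves only the four values of \<open>u\<close> at \<open>x, \<sigma> x, y, \<sigma> y\<close>
and the two kernel values \<open>K(x, y)\<close> and \<open>K(x, \<sigma> y)\<close>. Points on the same side of the line are
closer to each other than to each other's mirror images, so \<open>K(x, y) \<ge> K(x, \<sigma> y)\<close>, and
sorting both mirror pairs the same way increases the density
(\<open>reflected_energy_density_pol_le\<close>).

In the case of equality both energies agree, hence the densities agree for almost all pairs.
But the density grows strictly when \<open>x\<close> and \<open>y\<close> in \<open>H\<close> are such that \<open>\<Omega>\<close> contains \<open>x\<close> but
not \<open>\<sigma> x\<close>, and contains \<open>\<sigma> y\<close> but not \<open>y\<close>, because \<open>w\<close> is positive exactly on \<open>\<Omega>\<close> and the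
truncated kernel is strictly decreasing up to distance one. So one of the two sets of such
points is null (\<open>kept_or_gained_null\<close>), and then the polarized set is \<open>\<Omega>\<close> or its reflection
up to a null set.

What remains is that the supremum of the Rayleigh quotient is attained by a positive
eigenfunction (\<open>positive_continuous_maximizer\<close>). The kernel, as a function of one variable
with values in \<open>L\<^sup>2\<close> of the other, is continuous, so the operator turns a maximizing
sequence into an equicontinuous one, and Arzela-Ascoli supplies a uniform limit. A
maximizing sequence is nearly a sequence of eigenfunctions (\<open>residual_le_energy_gap\<close>), so
the limit is an eigenfunction.\<close>

section \<open>Square-integrable functions\<close>
definition square_integrable :: "'a measure \<Rightarrow> ('a \<Rightarrow> real) \<Rightarrow> bool" where
  "square_integrable M u \<longleftrightarrow> u \<in> borel_measurable M \<and> integrable M (\<lambda>x. (u x)\<^sup>2)"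

definition L2_inner :: "'a measure \<Rightarrow> ('a \<Rightarrow> real) \<Rightarrow> ('a \<Rightarrow> real) \<Rightarrow> real" where
  "L2_inner M u v = (LINT x|M. u x * v x)"

lemma square_integrable_measurable:
  "square_integrable M u \<Longrightarrow> u \<in> borel_measurable M"
  by (simp add: square_integrable_def)

lemma integrable_square_product:
  assumes "square_integrable M u" "square_integrable M v"
  shows "integrable M (\<lambda>x. u x * v x)"
proof (rule Bochner_Integration.integrable_bound)
  show "integrable M (\<lambda>x. (u x)\<^sup>2 + (v x)\<^sup>2)"
    using assms by (auto simp: square_integrable_def)
  show "(\<lambda>x. u x * v x) \<in> borel_measurable M"
    using assms by (auto simp: square_integrable_def)
  have "\<bar>a * b\<bar> \<le> a\<^sup>2 + b\<^sup>2" for a b :: real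
  proof -
    have "0 \<le> \<bar>a\<bar> * \<bar>b\<bar>" by simp
    then have "\<bar>a\<bar> * \<bar>b\<bar> \<le> \<bar>a\<bar>\<^sup>2 + \<bar>b\<bar>\<^sup>2"
      using sum_squares_bound[of "\<bar>a\<bar>" "\<bar>b\<bar>"] by linarith
    then show ?thesis by (simp add: abs_mult)
  qed
  then show "AE x in M. norm (u x * v x) \<le> norm ((u x)\<^sup>2 + (v x)\<^sup>2)" by auto
qed

lemma square_integrable_cmult:
  "square_integrable M u \<Longrightarrow> square_integrable M (\<lambda>x. c * u x)"
  by (auto simp: square_integrable_def power_mult_distrib)

lemma square_integrable_diff:
  assumes "square_integrable M u" "square_integrable M v"
  shows "square_integrable M (\<lambda>x. u x - v x)"
proof -
  have "integrable M (\<lambda>x. (u x)\<^sup>2 + (v x)\<^sup>2 - 2 * (u x * v x))"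
    using assms integrable_square_product[OF assms]
    by (intro Bochner_Integration.integrable_diff Bochner_Integration.integrable_add)
       (auto simp: square_integrable_def)
  moreover have "(\<lambda>x. (u x - v x)\<^sup>2) = (\<lambda>x. (u x)\<^sup>2 + (v x)\<^sup>2 - 2 * (u x * v x))"
    by (simp add: power2_diff mult.assoc)
  moreover have "(\<lambda>x. u x - v x) \<in> borel_measurable M"
    using assms by (intro borel_measurable_diff square_integrable_measurable)
  ultimately show ?thesis by (simp only: square_integrable_def)
qed

lemma square_integrable_abs:
  "square_integrable M u \<Longrightarrow> square_integrable M (\<lambda>x. \<bar>u x\<bar>)"
  by (auto simp: square_integrable_def)

lemma (in finite_measure) square_integrable_bounded:
  assumes "u \<in> borel_measurable M" "\<And>x. x \<in> space M \<Longrightarrow> \<bar>u x\<bar> \<le> B"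
  shows "square_integrable M u"
proof -
  have "integrable M (\<lambda>x. (u x)\<^sup>2)"
  proof (rule integrable_const_bound)
    have "(u x)\<^sup>2 \<le> B\<^sup>2" if "x \<in> space M" for x
      using power_mono[OF assms(2)[OF that], of 2] by simp
    then show "AE x in M. norm ((u x)\<^sup>2) \<le> B\<^sup>2" by (intro AE_I2) simp
    show "(\<lambda>x. (u x)\<^sup>2) \<in> borel_measurable M"
      by (rule borel_measurable_power[OF assms(1)])
  qed
  then show ?thesis using assms(1) by (simp add: square_integrable_def)
qed

lemma L2_inner_commute: "L2_inner M u v = L2_inner M v u"
  by (simp add: L2_inner_def mult.commute)

lemma L2_inner_self_nonneg: "0 \<le> L2_inner M u u"
  by (simp add: L2_inner_def)

lemma L2_inner_diff_left:
  assumes "square_integrable M u" "square_integrable M v" "square_integrable M w"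
  shows "L2_inner M (\<lambda>x. u x - v x) w = L2_inner M u w - L2_inner M v w"
  unfolding L2_inner_def left_diff_distrib
  using assms by (intro Bochner_Integration.integral_diff integrable_square_product)

lemma L2_inner_cmult_left: "L2_inner M (\<lambda>x. c * u x) w = c * L2_inner M u w"
  by (simp add: L2_inner_def mult.assoc)

lemma L2_inner_diff_right:
  assumes "square_integrable M u" "square_integrable M v" "square_integrable M w"
  shows "L2_inner M w (\<lambda>x. u x - v x) = L2_inner M w u - L2_inner M w v"
  using L2_inner_diff_left[OF assms] by (simp add: L2_inner_commute)

lemma L2_inner_cmult_right: "L2_inner M w (\<lambda>x. c * u x) = c * L2_inner M w u"
  using L2_inner_cmult_left[of M c u w] by (simp add: L2_inner_commute)

lemma L2_inner_self_eq_0_iff: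
  assumes "square_integrable M u"
  shows "L2_inner M u u = 0 \<longleftrightarrow> (AE x in M. u x = 0)"
  using assms integral_nonneg_eq_0_iff_AE[of M "\<lambda>x. u x * u x"]
  by (simp add: L2_inner_def square_integrable_def power2_eq_square)

lemma L2_Cauchy_Schwarz:
  assumes u: "square_integrable M u" and v: "square_integrable M v"
  shows "(L2_inner M u v)\<^sup>2 \<le> L2_inner M u u * L2_inner M v v"
proof -
  define a b c where "a = L2_inner M u u" and "b = L2_inner M u v" and "c = L2_inner M v v"
  have a: "0 \<le> a" and c: "0 \<le> c" by (simp_all add: a_def c_def L2_inner_self_nonneg)
  have poly: "0 \<le> a - 2 * t * b + t\<^sup>2 * c" for t
  proof -
    have tv: "square_integrable M (\<lambda>x. t * v x)" by (rule square_integrable_cmult[OF v])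
    have d: "square_integrable M (\<lambda>x. u x - t * v x)" by (rule square_integrable_diff[OF u tv])
    have "0 \<le> L2_inner M (\<lambda>x. u x - t * v x) (\<lambda>x. u x - t * v x)"
      by (rule L2_inner_self_nonneg)
    also have "\<dots> = a - 2 * t * b + t\<^sup>2 * c"
      unfolding L2_inner_diff_left[OF u tv d] L2_inner_diff_right[OF u tv u]
        L2_inner_diff_right[OF u tv v] L2_inner_cmult_left L2_inner_cmult_right
      by (simp add: a_def b_def c_def L2_inner_commute[of M v u] power2_eq_square algebra_simps)
    finally show ?thesis .
  qed
  show ?thesis
  proof (cases "c = 0")
    case True
    have "b = 0"
    proof (rule ccontr)
      assume "b \<noteq> 0"
      \<comment> \<open>The quadratic in \<open>t\<close> degenerates to the affine function \<open>a - 2 * t * b\<close>, here evaluated at value \<open>-1\<close>.\<close>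
      then show False using poly[of "(a + 1) / (2 * b)"] True by (simp add: field_simps)
    qed
    then show ?thesis using a c by (simp add: a_def b_def c_def)
  next
    case False
    then have "c > 0" using c by simp
    then show ?thesis using poly[of "b / c"]
      by (simp add: field_simps power2_eq_square flip: a_def b_def c_def)
  qed
qed

lemma L2_inner_abs_le:
  assumes "square_integrable M u" "square_integrable M v"
  shows "\<bar>L2_inner M u v\<bar> \<le> sqrt (L2_inner M u u) * sqrt (L2_inner M v v)"
  using real_sqrt_le_mono[OF L2_Cauchy_Schwarz[OF assms]] by (simp add: real_sqrt_mult)

lemma L2_inner_diff_self_le:
  assumes u: "square_integrable M u" and v: "square_integrable M v" and w: "square_integrable M w"
  shows "L2_inner M (\<lambda>x. u x - w x) (\<lambda>x. u x - w x)
     \<le> 2 * L2_inner M (\<lambda>x. u x - v x) (\<lambda>x. u x - v x)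
      + 2 * L2_inner M (\<lambda>x. v x - w x) (\<lambda>x. v x - w x)"
proof -
  note i = integrable_square_product[OF square_integrable_diff[OF u w] square_integrable_diff[OF u w]]
    integrable_square_product[OF square_integrable_diff[OF u v] square_integrable_diff[OF u v]]
    integrable_square_product[OF square_integrable_diff[OF v w] square_integrable_diff[OF v w]]
  have p: "(a - c) * (a - c) \<le> 2 * ((a - b) * (a - b)) + 2 * ((b - c) * (b - c))" for a b c :: real
    using zero_le_square[of "a - 2 * b + c"] by (simp add: algebra_simps)
  have "(LINT x|M. (u x - w x) * (u x - w x))
      \<le> (LINT x|M. 2 * ((u x - v x) * (u x - v x)) + 2 * ((v x - w x) * (v x - w x)))"
    by (rule integral_mono) (use i p in auto)
  also have "\<dots> = 2 * (LINT x|M. (u x - v x) * (u x - v x)) + 2 * (LINT x|M. (v x - w x) * (v x - w x))"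
    using i by simp
  finally show ?thesis by (simp add: L2_inner_def)
qed

section \<open>The top eigenvalue of a positive kernel operator\<close>

text \<open>The hypotheses on \<open>K\<close> make \<open>T\<close> a compact self-adjoint operator that improves positivity.
Compactness enters through the last assumption: the map \<open>x \<mapsto> K x\<close> into \<open>L\<^sup>2\<close> is continuous, so
\<open>T\<close> maps the unit ball to a bounded equicontinuous family on the compact set \<open>S\<close>. The set
\<open>S\<close> is kept apart from \<open>space M\<close> because the latter will be an open set, and Arzela-Ascoli
needs its closure.\<close>
locale positive_L2_kernel = finite_measure M
  for M :: "'a::euclidean_space measure" +
  fixes K :: "'a \<Rightarrow> 'a \<Rightarrow> real" and S :: "'a set" and C :: real
  assumes nonnull: "emeasure M (space M) \<noteq> 0"
    and compact_S: "compact S" and space_subset: "space M \<subseteq> S"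
    and K_measurable: "(\<lambda>(x, y). K x y) \<in> borel_measurable (M \<Otimes>\<^sub>M M)"
    and K_section: "\<And>x. x \<in> S \<Longrightarrow> square_integrable M (K x)"
    and K_bound: "\<And>x. x \<in> S \<Longrightarrow> L2_inner M (K x) (K x) \<le> C\<^sup>2"
    and C_nonneg: "0 \<le> C"
    and K_commute: "\<And>x y. K x y = K y x"
    and K_nonneg: "\<And>x y. 0 \<le> K x y"
    and K_pos: "\<And>x. x \<in> space M \<Longrightarrow> AE y in M. 0 < K x y"
    and K_continuous: "\<And>x e. x \<in> S \<Longrightarrow> 0 < e \<Longrightarrow>
          \<exists>d>0. \<forall>x'\<in>S. norm (x - x') < d \<longrightarrow>
            L2_inner M (\<lambda>y. K x y - K x' y) (\<lambda>y. K x y - K x' y) < e"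
begin

definition T :: "('a \<Rightarrow> real) \<Rightarrow> 'a \<Rightarrow> real" where
  "T u x = L2_inner M (K x) u"

definition energy :: "('a \<Rightarrow> real) \<Rightarrow> real" where
  "energy u = L2_inner M (T u) u"

lemma T_bound:
  assumes "square_integrable M u" "x \<in> S"
  shows "\<bar>T u x\<bar> \<le> C * sqrt (L2_inner M u u)"
proof -
  have "\<bar>T u x\<bar> \<le> sqrt (L2_inner M (K x) (K x)) * sqrt (L2_inner M u u)"
    unfolding T_def by (rule L2_inner_abs_le[OF K_section[OF assms(2)] assms(1)])
  also have "\<dots> \<le> C * sqrt (L2_inner M u u)"
    using real_sqrt_le_mono[OF K_bound[OF assms(2)]] C_nonneg
    by (intro mult_right_mono) (auto simp: L2_inner_self_nonneg)
  finally show ?thesis .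
qed

lemma T_measurable:
  assumes [measurable]: "u \<in> borel_measurable M"
  shows "T u \<in> borel_measurable M"
proof -
  note K_measurable[measurable]
  have "(\<lambda>x. LINT y|M. K x y * u y) \<in> borel_measurable M" by measurable
  then show ?thesis by (simp add: T_def[abs_def] L2_inner_def)
qed

lemma square_integrable_T:
  assumes "square_integrable M u"
  shows "square_integrable M (T u)"
  using T_bound[OF assms] space_subset assms
  by (intro square_integrable_bounded[of _ "C * sqrt (L2_inner M u u)"] T_measurable)
     (auto simp: square_integrable_def)

lemma T_diff_cmult:
  assumes "square_integrable M u" "square_integrable M v" "x \<in> S"
  shows "T (\<lambda>y. u y - t * v y) x = T u x - t * T v x"
  unfolding T_def
  by (simp add: L2_inner_diff_right[OF assms(1) square_integrable_cmult[OF assms(2)] K_section[OF assms(3)]]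
      L2_inner_cmult_right)

lemma T_cmult: "T (\<lambda>y. t * v y) x = t * T v x"
  unfolding T_def by (simp add: L2_inner_cmult_right)

text \<open>Fubini's theorem applies because \<open>\<integral>K(x,y)|u(y)|dy\<close> is bounded in \<open>x\<close>.\<close>
lemma T_selfadjoint:
  assumes u: "square_integrable M u" and v: "square_integrable M v"
  shows "L2_inner M (T u) v = L2_inner M (T v) u"
proof -
  interpret P: pair_sigma_finite M M ..
  note K_measurable[measurable]
  have [measurable]: "u \<in> borel_measurable M" "v \<in> borel_measurable M"
    using u v by (auto simp: square_integrable_def)
  define F where "F = (\<lambda>(x, y). K x y * u y * v x)"
  have "(\<lambda>p. (\<lambda>(x, y). K x y) p * u (snd p) * v (fst p)) \<in> borel_measurable (M \<Otimes>\<^sub>M M)"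
    by measurable
  then have F[measurable]: "F \<in> borel_measurable (M \<Otimes>\<^sub>M M)"
    by (simp add: F_def case_prod_beta')
  have inner: "integrable M (\<lambda>y. K x y * u y)" if "x \<in> space M" for x
    using integrable_square_product[OF K_section u] space_subset that by blast
  have absF: "(LINT y|M. norm (F (x, y))) = T (\<lambda>y. \<bar>u y\<bar>) x * \<bar>v x\<bar>" for x
    by (simp add: F_def T_def L2_inner_def abs_mult K_nonneg)
  have int: "integrable (M \<Otimes>\<^sub>M M) F"
  proof (rule P.Fubini_integrable[OF F])
    show "integrable M (\<lambda>x. LINT y|M. norm (F (x, y)))"
      unfolding absF
      by (intro integrable_square_product square_integrable_T square_integrable_abs u v)
    show "AE x in M. integrable M (\<lambda>y. F (x, y))"
      using inner by (auto simp: F_def)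
  qed
  have "L2_inner M (T u) v = (LINT x|M. (LINT y|M. F (x, y)))"
    by (simp add: L2_inner_def T_def F_def)
  also have "\<dots> = (LINT y|M. (LINT x|M. F (x, y)))"
    using P.Fubini_integral[of "\<lambda>x y. F (x, y)"] int by simp
  also have "\<dots> = L2_inner M (T v) u"
  proof -
    have "F (x, y) = K y x * v x * u y" for x y
      by (simp add: F_def K_commute[of x y])
    then show ?thesis
      by (simp add: L2_inner_def T_def)
  qed
  finally show ?thesis .
qed

text \<open>A nonnegative kernel lets absolute values pass inside both integrals.\<close>
lemma energy_abs_le: "square_integrable M u \<Longrightarrow> \<bar>energy u\<bar> \<le> energy (\<lambda>x. \<bar>u x\<bar>)"
proof -
  assume u: "square_integrable M u"
  note au = square_integrable_abs[OF u]
  have "\<bar>energy u\<bar> \<le> (LINT x|M. \<bar>T u x * u x\<bar>)"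
    unfolding energy_def L2_inner_def by (rule integral_abs_bound)
  also have "\<dots> \<le> (LINT x|M. T (\<lambda>x. \<bar>u x\<bar>) x * \<bar>u x\<bar>)"
  proof (rule integral_mono)
    show "integrable M (\<lambda>x. \<bar>T u x * u x\<bar>)"
      using integrable_square_product[OF square_integrable_T[OF u] u] by simp
    show "integrable M (\<lambda>x. T (\<lambda>x. \<bar>u x\<bar>) x * \<bar>u x\<bar>)"
      by (rule integrable_square_product[OF square_integrable_T[OF au] au])
    fix x assume "x \<in> space M"
    have "\<bar>T u x\<bar> \<le> (LINT y|M. \<bar>K x y * u y\<bar>)"
      unfolding T_def L2_inner_def by (rule integral_abs_bound)
    then have "\<bar>T u x\<bar> \<le> T (\<lambda>x. \<bar>u x\<bar>) x"
      by (simp add: T_def L2_inner_def abs_mult K_nonneg)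
    then show "\<bar>T u x * u x\<bar> \<le> T (\<lambda>x. \<bar>u x\<bar>) x * \<bar>u x\<bar>"
      by (simp add: abs_mult mult_right_mono)
  qed
  finally show ?thesis by (simp add: energy_def L2_inner_def)
qed

lemma energy_bound:
  assumes u: "square_integrable M u"
  shows "\<bar>energy u\<bar> \<le> C * sqrt (measure M (space M)) * L2_inner M u u"
proof -
  define n where "n = L2_inner M u u"
  have n: "0 \<le> n" by (simp add: n_def L2_inner_self_nonneg)
  have one: "square_integrable M (\<lambda>_. 1)" by (rule square_integrable_bounded[of _ 1]) auto
  have "L2_inner M (T u) (T u) \<le> (LINT x|M. C\<^sup>2 * n)"
    unfolding L2_inner_def
  proof (rule integral_mono)
    show "integrable M (\<lambda>x. T u x * T u x)"
      by (intro integrable_square_product square_integrable_T u)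
    fix x assume "x \<in> space M"
    then have "\<bar>T u x\<bar>\<^sup>2 \<le> (C * sqrt n)\<^sup>2"
      using T_bound[OF u] space_subset by (intro power_mono) (auto simp: n_def)
    then show "T u x * T u x \<le> C\<^sup>2 * n"
      using n by (simp add: power_mult_distrib flip: power2_eq_square)
  qed simp
  then have "L2_inner M (T u) (T u) \<le> (C * sqrt (measure M (space M)) * sqrt n)\<^sup>2"
    using n by (simp add: power_mult_distrib mult_ac)
  then have "sqrt (L2_inner M (T u) (T u)) \<le> C * sqrt (measure M (space M)) * sqrt n"
    using C_nonneg n by (intro real_le_lsqrt) auto
  then have "sqrt (L2_inner M (T u) (T u)) * sqrt n \<le> C * sqrt (measure M (space M)) * sqrt n * sqrt n"
    using n by (intro mult_right_mono) auto
  then show ?thesis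
    using L2_inner_abs_le[OF square_integrable_T[OF u] u] n
    by (simp add: energy_def mult.assoc flip: n_def)
qed

definition top_value :: real where
  "top_value = Sup {energy u | u. square_integrable M u \<and> L2_inner M u u = 1}"

lemma unit_energies_bdd_above:
  "bdd_above {energy u | u. square_integrable M u \<and> L2_inner M u u = 1}"
proof (rule bdd_aboveI)
  fix e assume "e \<in> {energy u | u. square_integrable M u \<and> L2_inner M u u = 1}"
  then obtain u where "e = energy u" "square_integrable M u" "L2_inner M u u = 1" by blast
  then show "e \<le> C * sqrt (measure M (space M))" using energy_bound[of u] by simp
qed

lemma energy_cmult: "energy (\<lambda>x. t * u x) = t\<^sup>2 * energy u"
proof -
  have "T (\<lambda>x. t * u x) = (\<lambda>x. t * T u x)" by (rule ext) (rule T_cmult)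
  then show ?thesis
    by (simp add: energy_def L2_inner_cmult_left L2_inner_cmult_right power2_eq_square)
qed

text \<open>By homogeneity; when \<open>u\<close> vanishes almost everywhere there is nothing to normalize, and the a
priori bound on the energy is used instead.\<close>
lemma energy_le_top_value:
  assumes u: "square_integrable M u"
  shows "energy u \<le> top_value * L2_inner M u u"
proof (cases "L2_inner M u u = 0")
  case True
  then show ?thesis using energy_bound[OF u] by simp
next
  case False
  define n where "n = L2_inner M u u"
  have n: "0 < n" using False L2_inner_self_nonneg[of M u] by (simp add: n_def)
  define v where "v = (\<lambda>x. (1 / sqrt n) * u x)"
  have "L2_inner M v v = 1"
    using n unfolding v_def L2_inner_cmult_left L2_inner_cmult_right by (simp flip: n_def)
  moreover have "square_integrable M v" unfolding v_def by (rule square_integrable_cmult[OF u])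
  ultimately have "energy v \<le> top_value"
    unfolding top_value_def by (intro cSup_upper unit_energies_bdd_above) auto
  moreover have "energy v = energy u / n"
    using n unfolding v_def energy_cmult by (simp add: power_divide)
  ultimately show ?thesis using n by (simp add: field_simps flip: n_def)
qed

lemma T_pos:
  assumes u: "square_integrable M u" and nonneg: "\<And>y. y \<in> space M \<Longrightarrow> 0 \<le> u y"
    and nz: "\<not> (AE y in M. u y = 0)" and x: "x \<in> space M"
  shows "0 < T u x"
proof -
  have xS: "x \<in> S" using x space_subset by blast
  have "0 \<le> T u x"
    unfolding T_def L2_inner_def by (rule integral_nonneg_AE) (use nonneg K_nonneg in auto)
  moreover have "T u x \<noteq> 0"
  proof
    assume "T u x = 0"
    then have "AE y in M. K x y * u y = 0"
      using nonneg K_nonneg integrable_square_product[OF K_section[OF xS] u]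
      by (subst (asm) T_def, subst (asm) L2_inner_def, subst (asm) integral_nonneg_eq_0_iff_AE) auto
    with K_pos[OF x] have "AE y in M. u y = 0" by eventually_elim auto
    with nz show False by simp
  qed
  ultimately show ?thesis by simp
qed

lemma top_value_pos: "0 < top_value"
proof -
  have one: "square_integrable M (\<lambda>_. 1)" by (rule square_integrable_bounded[of _ 1]) auto
  have nz: "\<not> (AE y in M. (1::real) = 0)"
    using nonnull by (simp add: eventually_False ae_filter_eq_bot_iff)
  have pos: "0 < T (\<lambda>_. 1) x" if "x \<in> space M" for x by (rule T_pos[OF one _ nz that]) simp
  have "energy (\<lambda>_. 1) \<noteq> 0"
  proof
    assume "energy (\<lambda>_. 1) = 0"
    moreover have "integrable M (T (\<lambda>_. 1))"
      using integrable_square_product[OF square_integrable_T[OF one] one] by simp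
    ultimately have "AE x in M. T (\<lambda>_. 1) x = 0"
      using pos unfolding energy_def L2_inner_def
      by (subst (asm) integral_nonneg_eq_0_iff_AE) (auto intro!: less_imp_le)
    with AE_space have "AE x in M. (1::real) = 0" by eventually_elim (use pos in force)
    with nz show False by simp
  qed
  moreover have "0 \<le> energy (\<lambda>_. 1)"
    using energy_abs_le[OF one] by simp
  ultimately have "0 < top_value * L2_inner M (\<lambda>_. 1) (\<lambda>_. 1)"
    using energy_le_top_value[OF one] by linarith
  then show ?thesis
    using L2_inner_self_nonneg[of M "\<lambda>_. 1"] by (auto simp: zero_less_mult_iff)
qed

text \<open>The quadratic form \<open>B u = top_value * \<parallel>u\<parallel>\<^sup>2 - energy u\<close> is nonnegative, and
\<open>B v \<le> 2 * top_value * \<parallel>v\<parallel>\<^sup>2\<close> because the kernel is positive, whence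
\<open>|energy v| \<le> energy |v|\<close>. The residual \<open>v\<close> is half the gradient of \<open>B\<close> at \<open>u\<close>, so
nonnegativity of \<open>B\<close> at the gradient step \<open>u - v / (2 * top_value)\<close> bounds \<open>\<parallel>v\<parallel>\<^sup>2\<close> by \<open>B u\<close>.
Along a maximizing sequence the residual therefore tends to zero: near-maximizers are
near-eigenfunctions.\<close>
lemma residual_le_energy_gap:
  assumes u: "square_integrable M u"
  defines "v \<equiv> (\<lambda>x. top_value * u x - T u x)"
  shows "L2_inner M v v \<le> 2 * top_value * (top_value * L2_inner M u u - energy u)"
proof -
  define L where "L = top_value"
  have L: "0 < L" using top_value_pos by (simp add: L_def)
  have Tu: "square_integrable M (T u)" by (rule square_integrable_T[OF u])
  have v: "square_integrable M v"
    unfolding v_def by (intro square_integrable_diff square_integrable_cmult u Tu)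
  have Tv: "square_integrable M (T v)" by (rule square_integrable_T[OF v])
  define n where "n = L2_inner M v v"
  have n: "n = L * L2_inner M u v - L2_inner M (T u) v"
    unfolding n_def by (subst (1) v_def)
      (simp add: L2_inner_diff_left[OF square_integrable_cmult[OF u] Tu v] L2_inner_cmult_left L_def)
  \<comment> \<open>The step size that minimizes the upper bound \<open>B u - 2 * t * n + 2 * t\<^sup>2 * L * n\<close> for \<open>B (u - t * v)\<close>.\<close>
  define t where "t = 1 / (2 * L)"
  define w where "w = (\<lambda>x. u x - t * v x)"
  have tv: "square_integrable M (\<lambda>x. t * v x)" by (rule square_integrable_cmult[OF v])
  have w: "square_integrable M w" unfolding w_def by (rule square_integrable_diff[OF u tv])
  have ww: "L2_inner M w w = L2_inner M u u - 2 * t * L2_inner M u v + t\<^sup>2 * n"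
    unfolding w_def n_def L2_inner_diff_left[OF u tv w[unfolded w_def]] L2_inner_diff_right[OF u tv u]
        L2_inner_diff_right[OF u tv v] L2_inner_cmult_left L2_inner_cmult_right
    by (simp add: L2_inner_commute[of M v u] power2_eq_square algebra_simps)
  have "energy w = L2_inner M (\<lambda>x. T u x - t * T v x) w"
    unfolding energy_def L2_inner_def
    using space_subset T_diff_cmult[OF u v, of _ t]
    by (intro Bochner_Integration.integral_cong) (auto simp: w_def)
  also have "\<dots> = energy u - 2 * t * L2_inner M (T u) v + t\<^sup>2 * energy v"
    unfolding w_def L2_inner_diff_left[OF Tu square_integrable_cmult[OF Tv] w[unfolded w_def]]
      L2_inner_diff_right[OF u tv Tu] L2_inner_diff_right[OF u tv Tv]
      L2_inner_cmult_left L2_inner_cmult_right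
    using T_selfadjoint[OF u v]
    by (simp add: energy_def power2_eq_square algebra_simps)
  finally have ew: "energy w = energy u - 2 * t * L2_inner M (T u) v + t\<^sup>2 * energy v" .
  have "- energy v \<le> L * n"
    using energy_abs_le[OF v] energy_le_top_value[OF square_integrable_abs[OF v]]
    by (simp add: n_def L_def L2_inner_def)
  then have "t\<^sup>2 * (- energy v) \<le> t\<^sup>2 * (L * n)" by (rule mult_left_mono) simp
  moreover have "energy w \<le> L * L2_inner M w w"
    using energy_le_top_value[OF w] by (simp add: L_def)
  ultimately have "0 \<le> (L * L2_inner M u u - energy u)
      - 2 * t * (L * L2_inner M u v - L2_inner M (T u) v) + 2 * t\<^sup>2 * L * n"
    unfolding ww ew by (simp add: algebra_simps)
  then have "0 \<le> (L * L2_inner M u u - energy u) - 2 * t * n + 2 * t\<^sup>2 * L * n"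
    by (simp only: n[symmetric])
  also have "\<dots> = (L * L2_inner M u u - energy u) - n / (2 * L)"
    using L by (simp add: t_def power2_eq_square field_simps)
  finally show ?thesis using L by (simp add: field_simps flip: n_def L_def)
qed

lemma maximizing_sequence:
  "\<exists>u. square_integrable M u \<and> L2_inner M u u = 1 \<and> (\<forall>x. 0 \<le> u x) \<and> top_value - e < energy u"
  if "0 < e"
proof -
  define A where "A = {energy u | u. square_integrable M u \<and> L2_inner M u u = 1}"
  have "A \<noteq> {}"
  proof -
    define m where "m = measure M (space M)"
    have m: "0 < m" using nonnull measure_nonneg[of M "space M"]
      by (auto simp: m_def emeasure_eq_measure less_le)
    have "square_integrable M (\<lambda>_. 1 / sqrt m)"
      by (rule square_integrable_bounded[of _ "1 / sqrt m"]) (use m in auto)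
    moreover have "L2_inner M (\<lambda>_. 1 / sqrt m) (\<lambda>_. 1 / sqrt m) = 1"
      using m by (simp add: L2_inner_def flip: m_def)
    ultimately show ?thesis unfolding A_def by blast
  qed
  moreover have "top_value - e < Sup A" using that by (simp add: top_value_def A_def)
  ultimately obtain a where "a \<in> A" "top_value - e < a"
    using less_cSupD by blast
  then obtain u where u: "square_integrable M u" "L2_inner M u u = 1" "top_value - e < energy u"
    unfolding A_def by blast
  show ?thesis
  proof (intro exI conjI)
    show "square_integrable M (\<lambda>x. \<bar>u x\<bar>)" by (rule square_integrable_abs[OF u(1)])
    show "L2_inner M (\<lambda>x. \<bar>u x\<bar>) (\<lambda>x. \<bar>u x\<bar>) = 1" using u(2) by (simp add: L2_inner_def)
    show "top_value - e < energy (\<lambda>x. \<bar>u x\<bar>)" using u(3) energy_abs_le[OF u(1)] by simp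
  qed auto
qed

text \<open>For a nonnegative maximizing sequence \<open>u\<^sub>n\<close>, Arzela-Ascoli gives a uniform limit \<open>g\<close> of a
subsequence of \<open>T u\<^sub>n\<close>. Since \<open>top_value * u\<^sub>n - T u\<^sub>n\<close> tends to zero in mean square, \<open>u\<^sub>n\<close>
itself converges in mean square to \<open>w = g / top_value\<close>, and passing to the limit in \<open>T u\<^sub>n\<close>
makes \<open>w\<close> an eigenfunction. Positivity of \<open>w = T w / top_value\<close> is inherited from the
kernel.\<close>
theorem positive_continuous_maximizer:
  obtains w where "continuous_on S w" "square_integrable M w" "\<And>x. x \<in> space M \<Longrightarrow> 0 < w x"
    "\<And>x. x \<in> S \<Longrightarrow> T w x = top_value * w x"
proof -
  define L where "L = top_value"
  have L: "0 < L" using top_value_pos by (simp add: L_def)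
  have "\<forall>n. \<exists>u. square_integrable M u \<and> L2_inner M u u = 1 \<and> (\<forall>x. 0 \<le> u x)
          \<and> L - inverse (real (Suc n)) < energy u"
    unfolding L_def by (intro allI maximizing_sequence) simp
  then obtain u where u: "\<And>n. square_integrable M (u n)" and u1: "\<And>n. L2_inner M (u n) (u n) = 1"
    and u0: "\<And>n x. 0 \<le> u n x" and uE: "\<And>n. L - inverse (real (Suc n)) < energy (u n)"
    by metis
  have bound: "norm (T (u n) x) \<le> C" if "x \<in> S" for n x using T_bound[OF u that, of n] by (simp add: u1)
  have equicont: "\<exists>d. 0 < d \<and> (\<forall>n y. y \<in> S \<and> norm (x - y) < d \<longrightarrow> norm (T (u n) x - T (u n) y) < e)"
    if x: "x \<in> S" and e: "0 < e" for x e
  proof -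
    obtain d where d: "d > 0" and dd: "\<And>y. y \<in> S \<Longrightarrow> norm (x - y) < d \<Longrightarrow>
        L2_inner M (\<lambda>z. K x z - K y z) (\<lambda>z. K x z - K y z) < e\<^sup>2"
      using K_continuous[OF x, of "e\<^sup>2"] e by auto
    have "norm (T (u n) x - T (u n) y) < e" if y: "y \<in> S" "norm (x - y) < d" for n y
    proof -
      have "\<bar>T (u n) x - T (u n) y\<bar> = \<bar>L2_inner M (\<lambda>z. K x z - K y z) (u n)\<bar>"
        unfolding T_def using L2_inner_diff_left[OF K_section[OF x] K_section[OF y(1)] u] by simp
      also have "\<dots> \<le> sqrt (L2_inner M (\<lambda>z. K x z - K y z) (\<lambda>z. K x z - K y z))"
        using L2_inner_abs_le[OF square_integrable_diff[OF K_section[OF x] K_section[OF y(1)]] u, of n]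
        by (simp add: u1)
      also have "\<dots> < sqrt (e\<^sup>2)" using dd[OF y] by (rule real_sqrt_less_mono)
      finally show ?thesis using e by simp
    qed
    then show ?thesis using d by blast
  qed
  obtain g k where g: "continuous_on S g" and k: "strict_mono (k :: nat \<Rightarrow> nat)"
    and conv: "\<And>e. 0 < e \<Longrightarrow> \<exists>N. \<forall>n x. n \<ge> N \<and> x \<in> S \<longrightarrow> norm (T (u (k n)) x - g x) < e"
    by (rule Arzela_Ascoli[OF compact_S bound equicont], assumption+) (rule that)
  have limT: "(\<lambda>n. T (u (k n)) x) \<longlonglongrightarrow> g x" if "x \<in> S" for x
    unfolding LIMSEQ_iff using conv that by meson
  have g_meas: "g \<in> borel_measurable M"
    by (rule borel_measurable_LIMSEQ_real[where u = "\<lambda>n. T (u (k n))"])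
       (use limT space_subset T_measurable square_integrable_measurable[OF u] in auto)
  have g_bd: "\<bar>g x\<bar> \<le> C" if "x \<in> S" for x
  proof (rule LIMSEQ_le_const2[OF tendsto_rabs[OF limT[OF that]]])
    show "\<exists>N. \<forall>n\<ge>N. \<bar>T (u (k n)) x\<bar> \<le> C" using T_bound[OF u that] by (simp add: u1)
  qed
  have g_L2: "square_integrable M g"
    by (rule square_integrable_bounded[OF g_meas, of C]) (use g_bd space_subset in auto)
  define m where "m = measure M (space M)"
  have m: "0 \<le> m" by (simp add: m_def)
  define w where "w = (\<lambda>x. (1 / L) * g x)"
  have w: "square_integrable M w" unfolding w_def by (rule square_integrable_cmult[OF g_L2])
  let ?r = "\<lambda>n. L2_inner M (\<lambda>x. u (k n) x - w x) (\<lambda>x. u (k n) x - w x)"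
  \<comment> \<open>\<open>L u\<^sub>n\<close> is close to \<open>T u\<^sub>n\<close> in mean square, and \<open>T u\<^sub>n\<close> is uniformly close to \<open>g\<close>.\<close>
  have "?r \<longlonglongrightarrow> 0"
  proof (rule LIMSEQ_I)
    fix e :: real assume e: "0 < e"
    \<comment> \<open>The residual and the uniform error contribute at most \<open>L\<^sup>2 * e / 4\<close> and \<open>L\<^sup>2 * e / 2\<close> to
      \<open>L\<^sup>2 * \<parallel>u - w\<parallel>\<^sup>2\<close>; the summand \<open>1\<close> keeps the denominator positive.\<close>
    define q where "q = sqrt (L\<^sup>2 * e / (4 * (m + 1)))"
    have q: "0 < q" "q\<^sup>2 = L\<^sup>2 * e / (4 * (m + 1))" using L e m by (auto simp: q_def)
    obtain N1 where N1: "\<And>n x. n \<ge> N1 \<Longrightarrow> x \<in> S \<Longrightarrow> norm (T (u (k n)) x - g x) < q"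
      using conv[OF q(1)] by blast
    obtain N2 where N2: "inverse (real (Suc N2)) < L * e / 16"
      using reals_Archimedean[of "L * e / 16"] L e by auto
    have "?r n < e" if n: "n \<ge> max N1 N2" for n
    proof -
      have kn: "n \<le> k n" by (rule seq_suble[OF k])
      have "L\<^sup>2 * ?r n = L2_inner M (\<lambda>x. L * u (k n) x - g x) (\<lambda>x. L * u (k n) x - g x)"
      proof -
        have "(\<lambda>x. L * u (k n) x - g x) = (\<lambda>x. L * (u (k n) x - w x))"
          using L by (auto simp: w_def field_simps)
        then show ?thesis
          by (simp only: L2_inner_cmult_left L2_inner_cmult_right power2_eq_square mult.assoc)
      qed
      also have "\<dots> \<le> 2 * L2_inner M (\<lambda>x. L * u (k n) x - T (u (k n)) x) (\<lambda>x. L * u (k n) x - T (u (k n)) x)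
          + 2 * L2_inner M (\<lambda>x. T (u (k n)) x - g x) (\<lambda>x. T (u (k n)) x - g x)"
        by (rule L2_inner_diff_self_le[OF square_integrable_cmult[OF u] square_integrable_T[OF u] g_L2])
      also have "L2_inner M (\<lambda>x. L * u (k n) x - T (u (k n)) x) (\<lambda>x. L * u (k n) x - T (u (k n)) x)
          \<le> 2 * L * (L - energy (u (k n)))"
        using residual_le_energy_gap[OF u, of "k n"] by (simp add: u1 L_def)
      also have "2 * L * (L - energy (u (k n))) \<le> 2 * L * (L * e / 16)"
      proof -
        have "inverse (real (Suc (k n))) \<le> inverse (real (Suc N2))"
          using n kn by (intro le_imp_inverse_le) auto
        then have "L - energy (u (k n)) \<le> L * e / 16" using uE[of "k n"] N2 by linarith
        then show ?thesis using L by (intro mult_left_mono) auto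
      qed
      also have "L2_inner M (\<lambda>x. T (u (k n)) x - g x) (\<lambda>x. T (u (k n)) x - g x) \<le> (LINT x|M. q\<^sup>2)"
        unfolding L2_inner_def
      proof (rule integral_mono)
        show "integrable M (\<lambda>x. (T (u (k n)) x - g x) * (T (u (k n)) x - g x))"
          by (intro integrable_square_product square_integrable_diff square_integrable_T u g_L2)
        fix x assume "x \<in> space M"
        then have "\<bar>T (u (k n)) x - g x\<bar>\<^sup>2 \<le> q\<^sup>2"
          using N1[of n x] n space_subset by (intro power_mono) (auto intro: less_imp_le)
        then show "(T (u (k n)) x - g x) * (T (u (k n)) x - g x) \<le> q\<^sup>2"
          by (simp add: power2_eq_square)
      qed simp
      finally have "L\<^sup>2 * ?r n \<le> 2 * (2 * L * (L * e / 16)) + 2 * (m * q\<^sup>2)"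
        by (simp add: m_def)
      also have "\<dots> < L\<^sup>2 * e"
      proof -
        have "m * q\<^sup>2 \<le> (m + 1) * q\<^sup>2" by (rule mult_right_mono) auto
        also have "\<dots> = L\<^sup>2 * e / 4" using m by (simp add: q(2) field_simps)
        finally have "m * q\<^sup>2 \<le> L\<^sup>2 * e / 4" .
        moreover have "0 < L\<^sup>2 * e" using L e by simp
        moreover have "2 * (2 * L * (L * e / 16)) = L\<^sup>2 * e / 4" by (simp add: power2_eq_square)
        ultimately show ?thesis by linarith
      qed
      finally show ?thesis using L by simp
    qed
    then show "\<exists>no. \<forall>n\<ge>no. norm (?r n - 0) < e"
      by (intro exI[of _ "max N1 N2"]) (simp add: abs_of_nonneg[OF L2_inner_self_nonneg])
  qed
  note lim_r = this
  have lim_sqrt: "(\<lambda>n. C * sqrt (?r n)) \<longlonglongrightarrow> 0"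
    using tendsto_mult_right_zero[OF tendsto_real_sqrt[OF lim_r, simplified]] by simp
  have Tw: "T w x = L * w x" if x: "x \<in> S" for x
  proof -
    have "(\<lambda>n. T (u (k n)) x - T w x) \<longlonglongrightarrow> 0"
    proof (rule tendsto_rabs_zero_cancel, rule tendsto_sandwich[OF _ _ tendsto_const lim_sqrt])
      show "\<forall>\<^sub>F n in sequentially. \<bar>T (u (k n)) x - T w x\<bar> \<le> C * sqrt (?r n)"
        using T_diff_cmult[OF u w x, of _ 1] T_bound[OF square_integrable_diff[OF u w] x] by simp
    qed auto
    then have "(\<lambda>n. T (u (k n)) x) \<longlonglongrightarrow> T w x" by (rule LIM_zero_cancel)
    then have "T w x = g x" using limT[OF x] LIMSEQ_unique by blast
    then show ?thesis using L by (simp add: w_def)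
  qed
  have w0: "0 \<le> w x" if "x \<in> S" for x
  proof -
    have "0 \<le> T (u n) x" for n
      unfolding T_def L2_inner_def using K_nonneg u0 by simp
    then have "0 \<le> g x" using LIMSEQ_le_const[OF limT[OF that], of 0] by blast
    then show ?thesis using L by (simp add: w_def)
  qed
  have nz: "\<not> (AE x in M. w x = 0)"
  proof
    assume "AE x in M. w x = 0"
    then have "?r n = L2_inner M (u (k n)) (u (k n))" for n
      using square_integrable_measurable[OF w] square_integrable_measurable[OF u]
      unfolding L2_inner_def by (intro integral_cong_AE) auto
    then have "(\<lambda>n. 1::real) \<longlonglongrightarrow> 0" using lim_r by (simp add: u1)
    then show False using LIMSEQ_unique[OF tendsto_const] zero_neq_one by metis
  qed
  show ?thesis
  proof
    show "continuous_on S w" unfolding w_def by (intro continuous_intros g)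
    show "square_integrable M w" by (rule w)
    show "T w x = top_value * w x" if "x \<in> S" for x using Tw[OF that] by (simp add: L_def)
    fix x assume x: "x \<in> space M"
    have "0 < T w x" by (rule T_pos[OF w _ nz x]) (use w0 space_subset in auto)
    then show "0 < w x" using Tw[of x] x space_subset L by (auto simp: zero_less_mult_iff)
  qed
qed

end

section \<open>The truncated logarithmic kernel\<close>

text \<open>The factor \<open>max 0\<close> changes nothing on a set of diameter at most one, where the logarithm is
nonnegative. It makes the kernel nonnegative and square integrable in each variable on the
whole plane, so that sets and their reflections can be treated with one kernel and with
integrals over the whole plane. On the diagonal the value is \<open>0\<close> because \<open>1 / 0 = 0\<close> and
\<open>ln 0 = 0\<close>; hence monotonicity in the distance requires \<open>x \<noteq> y\<close> below.\<close>
definition log_kernel :: "real^2 \<Rightarrow> real^2 \<Rightarrow> real" where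
  "log_kernel x y = max 0 (ln (1 / norm (x - y))) / (2 * pi)"

lemma log_kernel_commute: "log_kernel x y = log_kernel y x"
  by (simp add: log_kernel_def norm_minus_commute)

lemma log_kernel_nonneg: "0 \<le> log_kernel x y"
  by (simp add: log_kernel_def)

lemma log_kernel_pos: "x \<noteq> y \<Longrightarrow> norm (x - y) < 1 \<Longrightarrow> 0 < log_kernel x y"
  by (simp add: log_kernel_def max_def)

lemma log_kernel_antimono:
  assumes "x \<noteq> y" "norm (x - y) \<le> norm (x' - y')"
  shows "log_kernel x' y' \<le> log_kernel x y"
proof -
  have pos: "0 < norm (x - y)" "0 < norm (x' - y')" using assms by auto
  then have "ln (1 / norm (x' - y')) \<le> ln (1 / norm (x - y))"
    using assms(2) by (intro ln_mono divide_left_mono mult_pos_pos) auto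
  then show ?thesis unfolding log_kernel_def by (intro divide_right_mono) auto
qed

lemma log_kernel_strict_antimono:
  assumes "x \<noteq> y" "norm (x - y) < norm (x' - y')" "norm (x' - y') \<le> 1"
  shows "log_kernel x' y' < log_kernel x y"
proof -
  have pos: "0 < norm (x - y)" "0 < norm (x' - y')" using assms by auto
  then have "ln (1 / norm (x' - y')) < ln (1 / norm (x - y))"
    using assms(2) by (subst ln_less_cancel_iff) (auto intro!: divide_strict_left_mono mult_pos_pos)
  moreover have "0 \<le> ln (1 / norm (x' - y'))"
    using assms(3) pos by (intro ln_ge_zero) (simp add: le_divide_eq)
  ultimately show ?thesis unfolding log_kernel_def by (intro divide_strict_right_mono) auto
qed

lemma log_kernel_measurable [measurable (raw)]:
  assumes [measurable]: "f \<in> borel_measurable M" "g \<in> borel_measurable M"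
  shows "(\<lambda>z. log_kernel (f z) (g z)) \<in> borel_measurable M"
  unfolding log_kernel_def by measurable

text \<open>From \<open>ln s \<le> s - 1\<close> at \<open>s = 1 / sqrt r\<close> one gets \<open>ln (1 / r) \<le> 2 / sqrt r\<close>, and \<open>1 / |z|\<close> is
integrable near the origin of the plane.\<close>
lemma log_kernel_square_le:
  assumes "x \<noteq> y"
  shows "(log_kernel x y)\<^sup>2 \<le> 1 / norm (x - y)"
proof -
  define r where "r = norm (x - y)"
  have r: "0 < r" using assms by (simp add: r_def)
  have "max 0 (ln (1 / r)) \<le> 2 / sqrt r"
  proof -
    have "ln (1 / r) = 2 * ln (1 / sqrt r)" using r by (simp add: ln_div ln_sqrt)
    also have "\<dots> \<le> 2 * (1 / sqrt r - 1)" using r by (intro mult_left_mono ln_le_minus_one) auto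
    finally show ?thesis using r by (simp add: max_def)
  qed
  then have "(max 0 (ln (1 / r)) / (2 * pi))\<^sup>2 \<le> (2 / sqrt r / (2 * pi))\<^sup>2"
    by (intro power_mono divide_right_mono) auto
  also have "\<dots> = 1 / r * (1 / pi\<^sup>2)"
    using r by (simp add: power_divide power_mult_distrib)
  also have "\<dots> \<le> 1 / r * 1"
  proof -
    have "1 \<le> pi\<^sup>2" using pi_ge_two by (intro one_le_power) linarith
    then show ?thesis using r by (intro mult_left_mono) (auto simp: field_simps)
  qed
  finally show ?thesis by (simp add: log_kernel_def r_def)
qed

lemma log_kernel_translate: "log_kernel x y = log_kernel 0 (- x + y)"
  by (simp add: log_kernel_def norm_minus_commute)

definition log_kernel_mass :: ennreal where
  "log_kernel_mass = (\<integral>\<^sup>+z. ennreal ((log_kernel 0 z)\<^sup>2) \<partial>lborel)"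

lemma nn_integral_log_kernel_square:
  "(\<integral>\<^sup>+y. ennreal ((log_kernel x y)\<^sup>2) \<partial>lborel) = log_kernel_mass"
proof -
  have "log_kernel_mass = (\<integral>\<^sup>+z. ennreal ((log_kernel 0 z)\<^sup>2) \<partial>distr lborel borel ((+) (- x)))"
    by (simp add: lborel_distr_plus log_kernel_mass_def)
  also have "\<dots> = (\<integral>\<^sup>+y. ennreal ((log_kernel 0 (- x + y))\<^sup>2) \<partial>lborel)"
    by (subst nn_integral_distr) auto
  also have "\<dots> = (\<integral>\<^sup>+y. ennreal ((log_kernel x y)\<^sup>2) \<partial>lborel)"
    by (simp only: log_kernel_translate[of x, symmetric])
  finally show ?thesis by (rule sym)
qed

lemma dyadic_bracket:
  fixes r :: real
  assumes "0 < r" "r \<le> 1"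
  obtains n where "(1/2) ^ Suc n < r" "r \<le> (1/2) ^ n"
proof -
  define N where "N = (LEAST n. (1/2) ^ n < r)"
  have ex: "\<exists>n. (1/2) ^ n < r" using real_arch_pow_inv[of r "1/2"] assms by auto
  have N: "(1/2) ^ N < r" unfolding N_def by (rule LeastI_ex[OF ex])
  then obtain n where n: "N = Suc n" using assms(2) by (cases N) auto
  then have "\<not> (1/2) ^ n < r" unfolding N_def using not_less_Least by (metis lessI)
  then show ?thesis using N n that[of n] by auto
qed

text \<open>On the punctured unit disc \<open>1 / |z|\<close> is at most the sum of \<open>2 ^ (m + 1)\<close> over the discs of
radius \<open>1 / 2 ^ m\<close> about the origin that contain \<open>z\<close>. Their areas decay like \<open>1 / 4 ^ m\<close>, so
the integrals of the summands form a convergent geometric series.\<close>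
lemma log_kernel_mass_finite: "log_kernel_mass < \<infinity>"
proof -
  define c where "c = unit_ball_vol (real DIM(real^2))"
  have c: "0 \<le> c" by (simp add: c_def)
  define g where "g = (\<lambda>m (z::real^2). ennreal (2 ^ Suc m) * indicator (cball 0 ((1/2) ^ m)) z)"
  have [measurable]: "g m \<in> borel_measurable borel" for m
    unfolding g_def by (intro borel_measurable_times_ennreal borel_measurable_const borel_measurable_indicator) simp
  have "ennreal ((log_kernel 0 z)\<^sup>2) \<le> (\<Sum>m. g m z)" if "z \<noteq> 0" for z
  proof (cases "norm z \<le> 1")
    case True
    obtain n where n: "(1/2) ^ Suc n < norm z" "norm z \<le> (1/2) ^ n"
      using dyadic_bracket[of "norm z"] True \<open>z \<noteq> 0\<close> by auto
    have "(log_kernel 0 z)\<^sup>2 \<le> 1 / norm z"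
      using log_kernel_square_le[of 0 z] \<open>z \<noteq> 0\<close> by simp
    also have "\<dots> \<le> 1 / (1/2) ^ Suc n"
      using n \<open>z \<noteq> 0\<close> by (intro divide_left_mono) auto
    also have "\<dots> = 2 ^ Suc n" by (simp add: power_one_over field_simps)
    finally have "ennreal ((log_kernel 0 z)\<^sup>2) \<le> g n z"
      using n(2) by (simp add: ennreal_leI g_def)
    also have "\<dots> \<le> (\<Sum>m. g m z)"
      using sum_le_suminf[of "\<lambda>m. g m z" "{n}"] by simp
    finally show ?thesis .
  next
    case False
    then have "log_kernel 0 z = 0"
      by (simp add: log_kernel_def max_def ln_div)
    then show ?thesis by simp
  qed
  moreover have "AE z in lborel. z \<noteq> (0::real^2)" by (rule AE_lborel_singleton)
  ultimately have "log_kernel_mass \<le> (\<integral>\<^sup>+z. (\<Sum>m. g m z) \<partial>lborel)"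
    unfolding log_kernel_mass_def by (intro nn_integral_mono_AE) auto
  also have "\<dots> = (\<Sum>m. \<integral>\<^sup>+z. g m z \<partial>lborel)"
    by (intro nn_integral_suminf) simp
  also have "\<dots> = (\<Sum>m. ennreal (2 * c * (1/2) ^ m))"
  proof (rule arg_cong[where f = suminf], rule ext)
    fix m
    have "(\<integral>\<^sup>+z. g m z \<partial>lborel) = ennreal (2 ^ Suc m) * ennreal (c * ((1/2) ^ m) ^ 2)"
      unfolding g_def by (subst nn_integral_cmult_indicator) (auto simp: emeasure_cball c_def)
    also have "\<dots> = ennreal (2 ^ Suc m * (c * ((1/2) ^ m) ^ 2))"
      by (subst ennreal_mult) (auto simp: c)
    also have "2 ^ Suc m * (c * ((1/2) ^ m) ^ 2) = 2 * c * (1/2) ^ m"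
      by (simp add: power_one_over power2_eq_square field_simps)
    finally show "(\<integral>\<^sup>+z. g m z \<partial>lborel) = ennreal (2 * c * (1/2) ^ m)" .
  qed
  also have "\<dots> < \<infinity>"
  proof -
    have "summable (\<lambda>m. 2 * c * (1/2) ^ m)" by (intro summable_mult summable_geometric) simp
    then show ?thesis using c by (subst suminf_ennreal_eq[OF _ summable_sums]) auto
  qed
  finally show ?thesis .
qed

lemma log_kernel_square_integrable: "integrable lborel (\<lambda>y. (log_kernel x y)\<^sup>2)"
proof (rule integrableI_nonneg)
  show "(\<integral>\<^sup>+y. ennreal ((log_kernel x y)\<^sup>2) \<partial>lborel) < \<infinity>"
    unfolding nn_integral_log_kernel_square by (rule log_kernel_mass_finite)
  show "(\<lambda>y. (log_kernel x y)\<^sup>2) \<in> borel_measurable lborel"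
    unfolding measurable_lborel1 by measurable
  show "AE y in lborel. 0 \<le> (log_kernel x y)\<^sup>2" by (rule AE_I2) (rule zero_le_power2)
qed

lemma nn_integral_lebesgue_on:
  assumes "A \<in> sets lebesgue"
  shows "(\<integral>\<^sup>+x. f x \<partial>lebesgue_on A) = (\<integral>\<^sup>+x. f x * indicator A x \<partial>lborel)"
proof -
  have "A \<inter> space lebesgue \<in> sets lebesgue" using assms by simp
  then show ?thesis by (subst nn_integral_restrict_space) (assumption, rule nn_integral_completion)
qed

text \<open>For nonnegative numbers \<open>(p - q)\<^sup>2 \<le> |p\<^sup>2 - q\<^sup>2|\<close>, so convergence in \<open>L\<^sup>2\<close> reduces to
convergence of the squares in \<open>L\<^sup>1\<close>. The squares converge pointwise off one point and all
have the same integral by translation invariance, which is the situation of Scheffe's lemma.\<close>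
lemma log_kernel_L2_continuous:
  assumes "0 < e"
  shows "\<exists>d>0. \<forall>x'. norm (x - x') < d \<longrightarrow>
    (\<integral>\<^sup>+y. ennreal ((log_kernel x y - log_kernel x' y)\<^sup>2) \<partial>lborel) < ennreal e"
proof (rule ccontr)
  define G where "G = (\<lambda>x'. \<integral>\<^sup>+y. ennreal ((log_kernel x y - log_kernel x' y)\<^sup>2) \<partial>lborel)"
  assume "\<not> ?thesis"
  then have neg: "\<not> (\<exists>d>0. \<forall>x'. norm (x - x') < d \<longrightarrow> G x' < ennreal e)"
    by (simp only: G_def not_False_eq_True)
  have "\<forall>n. \<exists>x'. norm (x - x') < inverse (real (Suc n)) \<and> \<not> G x' < ennreal e"
  proof
    fix n
    have "0 < inverse (real (Suc n))" by simp
    with neg show "\<exists>x'. norm (x - x') < inverse (real (Suc n)) \<and> \<not> G x' < ennreal e" by blast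
  qed
  then obtain X where "\<forall>n. norm (x - X n) < inverse (real (Suc n)) \<and> \<not> G (X n) < ennreal e"
    by (rule choice[THEN exE])
  then have X: "norm (x - X n) < inverse (real (Suc n))" and ge: "\<not> G (X n) < ennreal e" for n
    by blast+
  have limX: "X \<longlonglongrightarrow> x"
  proof (rule metric_LIMSEQ_I)
    fix r :: real assume "0 < r"
    then obtain N where N: "inverse (real (Suc N)) < r" using reals_Archimedean by blast
    have "dist (X n) x < r" if "n \<ge> N" for n
    proof -
      have "inverse (real (Suc n)) \<le> inverse (real (Suc N))" using that by (intro le_imp_inverse_le) auto
      then have "norm (x - X n) < r" using X[of n] N by linarith
      then show ?thesis by (simp add: dist_norm norm_minus_commute)
    qed
    then show "\<exists>no. \<forall>n\<ge>no. dist (X n) x < r" by blast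
  qed
  have "(\<lambda>n. \<integral>\<^sup>+y. ennreal (norm ((log_kernel (X n) y)\<^sup>2 - (log_kernel x y)\<^sup>2)) \<partial>lborel) \<longlonglongrightarrow> 0"
  proof (rule Scheffe_lemma1)
    show "AE y in lborel. (\<lambda>n. (log_kernel (X n) y)\<^sup>2) \<longlonglongrightarrow> (log_kernel x y)\<^sup>2"
    proof -
      have "(\<lambda>n. (log_kernel (X n) y)\<^sup>2) \<longlonglongrightarrow> (log_kernel x y)\<^sup>2" if "y \<noteq> x" for y
        unfolding log_kernel_def using that by (intro tendsto_intros limX) auto
      then show ?thesis using AE_lborel_singleton[of x] by auto
    qed
  qed (auto simp: log_kernel_square_integrable nn_integral_log_kernel_square Limsup_const)
  then have "\<forall>\<^sub>F n in sequentially.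
      (\<integral>\<^sup>+y. ennreal (norm ((log_kernel (X n) y)\<^sup>2 - (log_kernel x y)\<^sup>2)) \<partial>lborel) < ennreal e"
    using assms by (intro order_tendstoD(2)) auto
  then obtain n where n:
      "(\<integral>\<^sup>+y. ennreal (norm ((log_kernel (X n) y)\<^sup>2 - (log_kernel x y)\<^sup>2)) \<partial>lborel) < ennreal e"
    using eventually_happens'[OF sequentially_bot] by blast
  have sq: "(a - b)\<^sup>2 \<le> norm (b\<^sup>2 - a\<^sup>2)" if "0 \<le> a" "0 \<le> b" for a b :: real
  proof -
    have "\<bar>a - b\<bar> * \<bar>a - b\<bar> \<le> \<bar>a - b\<bar> * \<bar>a + b\<bar>" using that by (intro mult_left_mono) auto
    also have "\<dots> = \<bar>b\<^sup>2 - a\<^sup>2\<bar>" by (simp flip: abs_mult) (simp add: power2_eq_square algebra_simps)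
    finally show ?thesis by (simp flip: power2_eq_square)
  qed
  have "(\<integral>\<^sup>+y. ennreal ((log_kernel x y - log_kernel (X n) y)\<^sup>2) \<partial>lborel)
     \<le> (\<integral>\<^sup>+y. ennreal (norm ((log_kernel (X n) y)\<^sup>2 - (log_kernel x y)\<^sup>2)) \<partial>lborel)"
    by (intro nn_integral_mono ennreal_leI sq log_kernel_nonneg)
  then have "G (X n) \<le> (\<integral>\<^sup>+y. ennreal (norm ((log_kernel (X n) y)\<^sup>2 - (log_kernel x y)\<^sup>2)) \<partial>lborel)"
    by (simp only: G_def)
  with n ge[of n] show False by auto
qed

section \<open>The variational characterization of the largest eigenvalue\<close>
lemma borel_measurable_lebesgue_onI:
  "f \<in> borel_measurable borel \<Longrightarrow> f \<in> borel_measurable (lebesgue_on A)"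
  by (rule measurable_restrict_space1) (simp add: measurable_completion)

lemma
  fixes f :: "'a::euclidean_space \<Rightarrow> real"
  assumes A: "A \<in> sets lebesgue" and f: "f \<in> borel_measurable borel" and nonneg: "\<And>x. 0 \<le> f x"
    and fin: "(\<integral>\<^sup>+x. ennreal (f x) \<partial>lborel) < \<infinity>"
  shows integrable_lebesgue_on: "integrable (lebesgue_on A) f"
    and integral_lebesgue_on_le: "ennreal (LINT x|lebesgue_on A. f x) \<le> (\<integral>\<^sup>+x. ennreal (f x) \<partial>lborel)"
proof -
  have le: "(\<integral>\<^sup>+x. ennreal (f x) \<partial>lebesgue_on A) \<le> (\<integral>\<^sup>+x. ennreal (f x) \<partial>lborel)"
    unfolding nn_integral_lebesgue_on[OF A] by (intro nn_integral_mono) (simp split: split_indicator)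
  show int: "integrable (lebesgue_on A) f"
  proof (rule integrableI_nonneg)
    show "f \<in> borel_measurable (lebesgue_on A)" by (rule borel_measurable_lebesgue_onI[OF f])
    show "AE x in lebesgue_on A. 0 \<le> f x" using nonneg by (intro AE_I2)
    show "(\<integral>\<^sup>+x. ennreal (f x) \<partial>lebesgue_on A) < \<infinity>" using le fin by (rule order_le_less_trans)
  qed
  have "ennreal (LINT x|lebesgue_on A. f x) = (\<integral>\<^sup>+x. ennreal (f x) \<partial>lebesgue_on A)"
    by (rule nn_integral_eq_integral[OF int, symmetric]) (use nonneg in \<open>intro AE_I2\<close>)
  then show "ennreal (LINT x|lebesgue_on A. f x) \<le> (\<integral>\<^sup>+x. ennreal (f x) \<partial>lborel)" using le by simp
qed

lemma log_kernel_positive_L2_kernel: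
  assumes "open \<Omega>" "bounded \<Omega>" "\<Omega> \<noteq> {}" "diameter \<Omega> \<le> 1"
  shows "positive_L2_kernel (lebesgue_on \<Omega>) log_kernel (closure \<Omega>) (sqrt (enn2real log_kernel_mass))"
proof -
  have lm: "\<Omega> \<in> lmeasurable" using assms(1,2) lmeasurable_open by blast
  then have sets: "\<Omega> \<in> sets lebesgue" by (rule fmeasurableD)
  have sq: "square_integrable (lebesgue_on \<Omega>) (log_kernel x)" for x
    unfolding square_integrable_def
  proof
    show "log_kernel x \<in> borel_measurable (lebesgue_on \<Omega>)"
      by (rule borel_measurable_lebesgue_onI) measurable
    show "integrable (lebesgue_on \<Omega>) (\<lambda>y. (log_kernel x y)\<^sup>2)"
      by (rule integrable_lebesgue_on[OF sets])
         (simp_all add: nn_integral_log_kernel_square log_kernel_mass_finite[simplified])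
  qed
  show ?thesis
  proof (rule positive_L2_kernel.intro)
    show "finite_measure (lebesgue_on \<Omega>)" by (rule finite_measure_lebesgue_on[OF lm])
    show "positive_L2_kernel_axioms (lebesgue_on \<Omega>) log_kernel (closure \<Omega>) (sqrt (enn2real log_kernel_mass))"
    proof
      have "emeasure lebesgue \<Omega> \<noteq> 0"
        using open_not_negligible[OF assms(1,3)] sets
        by (auto simp: negligible_iff_null_sets null_sets_def)
      then show "emeasure (lebesgue_on \<Omega>) (space (lebesgue_on \<Omega>)) \<noteq> 0"
        using sets by (simp add: emeasure_restrict_space space_restrict_space)
      show "compact (closure \<Omega>)" using assms(2) by (simp add: compact_closure)
      show "space (lebesgue_on \<Omega>) \<subseteq> closure \<Omega>"
        by (simp add: space_restrict_space closure_subset)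
      have [measurable]: "(\<lambda>x. x) \<in> borel_measurable (lebesgue_on \<Omega>)"
        by (rule borel_measurable_lebesgue_onI) simp
      have [measurable]: "fst \<in> borel_measurable (lebesgue_on \<Omega> \<Otimes>\<^sub>M lebesgue_on \<Omega>)"
        by (rule measurable_compose[OF measurable_fst]) measurable
      have [measurable]: "snd \<in> borel_measurable (lebesgue_on \<Omega> \<Otimes>\<^sub>M lebesgue_on \<Omega>)"
        by (rule measurable_compose[OF measurable_snd]) measurable
      show "(\<lambda>(x, y). log_kernel x y) \<in> borel_measurable (lebesgue_on \<Omega> \<Otimes>\<^sub>M lebesgue_on \<Omega>)"
        unfolding case_prod_beta' by (rule log_kernel_measurable) measurable
      show "square_integrable (lebesgue_on \<Omega>) (log_kernel x)" for x by (rule sq)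
      show "L2_inner (lebesgue_on \<Omega>) (log_kernel x) (log_kernel x) \<le> (sqrt (enn2real log_kernel_mass))\<^sup>2" for x
      proof -
        have "ennreal (LINT y|lebesgue_on \<Omega>. (log_kernel x y)\<^sup>2) \<le> log_kernel_mass"
          unfolding nn_integral_log_kernel_square[of x, symmetric]
          by (rule integral_lebesgue_on_le[OF sets])
             (simp_all add: nn_integral_log_kernel_square log_kernel_mass_finite[simplified])
        then have "enn2real (ennreal (LINT y|lebesgue_on \<Omega>. (log_kernel x y)\<^sup>2)) \<le> enn2real log_kernel_mass"
          using log_kernel_mass_finite by (intro enn2real_mono) auto
        then show ?thesis by (simp add: L2_inner_def power2_eq_square)
      qed
      show "0 \<le> sqrt (enn2real log_kernel_mass)" by simp
      show "log_kernel x y = log_kernel y x" for x y by (rule log_kernel_commute)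
      show "0 \<le> log_kernel x y" for x y by (rule log_kernel_nonneg)
      show "AE y in lebesgue_on \<Omega>. 0 < log_kernel x y" if x: "x \<in> space (lebesgue_on \<Omega>)" for x
      proof -
        have x\<Omega>: "x \<in> \<Omega>" using x by (simp add: space_restrict_space)
        have "insert x (sphere x 1) \<in> null_sets lebesgue"
          using negligible_sphere[of x 1] by (simp add: negligible_iff_null_sets[symmetric])
        then have "AE y in lebesgue. y \<notin> insert x (sphere x 1)" by (rule AE_not_in)
        then have "AE y in lebesgue. y \<in> \<Omega> \<longrightarrow> 0 < log_kernel x y"
        proof eventually_elim
          case (elim y)
          show ?case
          proof
            assume "y \<in> \<Omega>"
            then have "dist x y \<le> 1"
              using diameter_bounded_bound[OF assms(2) x\<Omega>] assms(4) by fastforce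
            then show "0 < log_kernel x y"
              using elim by (intro log_kernel_pos) (auto simp: dist_norm)
          qed
        qed
        then show ?thesis using sets by (simp add: AE_restrict_space_iff)
      qed
      fix x and e :: real
      assume "0 < e"
      then obtain d where d: "d > 0" and dd: "\<And>x'. norm (x - x') < d \<Longrightarrow>
          (\<integral>\<^sup>+y. ennreal ((log_kernel x y - log_kernel x' y)\<^sup>2) \<partial>lborel) < ennreal e"
        using log_kernel_L2_continuous[of e x] by auto
      have "L2_inner (lebesgue_on \<Omega>) (\<lambda>y. log_kernel x y - log_kernel x' y) (\<lambda>y. log_kernel x y - log_kernel x' y) < e"
        if "norm (x - x') < d" for x'
      proof -
        have "ennreal (LINT y|lebesgue_on \<Omega>. (log_kernel x y - log_kernel x' y)\<^sup>2)
            \<le> (\<integral>\<^sup>+y. ennreal ((log_kernel x y - log_kernel x' y)\<^sup>2) \<partial>lborel)"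
          by (rule integral_lebesgue_on_le[OF sets])
             (use dd[OF that] in \<open>auto simp: less_top[symmetric] elim: order_less_trans\<close>)
        also have "\<dots> < ennreal e" by (rule dd[OF that])
        finally show ?thesis using \<open>0 < e\<close> by (simp add: ennreal_less_iff L2_inner_def power2_eq_square)
      qed
      then show "\<exists>d>0. \<forall>x'\<in>closure \<Omega>. norm (x - x') < d \<longrightarrow>
          L2_inner (lebesgue_on \<Omega>) (\<lambda>y. log_kernel x y - log_kernel x' y) (\<lambda>y. log_kernel x y - log_kernel x' y) < e"
        using d by blast
    qed
  qed
qed

locale log_domain =
  fixes \<Omega> :: "(real^2) set"
  assumes open_domain: "open \<Omega>" and bounded_domain: "bounded \<Omega>"
    and domain_nonempty: "\<Omega> \<noteq> {}" and diameter_le_1: "diameter \<Omega> \<le> 1"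

sublocale log_domain \<subseteq> positive_L2_kernel "lebesgue_on \<Omega>" log_kernel "closure \<Omega>" "sqrt (enn2real log_kernel_mass)"
  by (rule log_kernel_positive_L2_kernel[OF open_domain bounded_domain domain_nonempty diameter_le_1])

context log_domain
begin

lemma domain_measurable: "\<Omega> \<in> sets lebesgue"
  using open_domain by (simp add: borel_open sets_completionI_sets)

lemma norm_diff_le_1: "x \<in> \<Omega> \<Longrightarrow> y \<in> \<Omega> \<Longrightarrow> norm (x - y) \<le> 1"
  using diameter_bounded_bound[OF bounded_domain, of x y] diameter_le_1 by (simp add: dist_norm)

lemma log_potential_eq_T:
  assumes "x \<in> \<Omega>"
  shows "log_potential \<Omega> u x = T u x"
proof -
  have K: "ln (1 / norm (x - y)) = 2 * pi * log_kernel x y" if "y \<in> \<Omega>" for y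
  proof (cases "x = y")
    case False
    then have "0 \<le> ln (1 / norm (x - y))"
      using norm_diff_le_1[OF assms that] by (intro ln_ge_zero) (simp add: le_divide_eq)
    then show ?thesis by (simp add: log_kernel_def)
  qed (simp add: log_kernel_def)
  have "(LINT y|lebesgue_on \<Omega>. ln (1 / norm (x - y)) * u y)
      = (LINT y|lebesgue_on \<Omega>. 2 * pi * (log_kernel x y * u y))"
    by (rule Bochner_Integration.integral_cong) (use K in \<open>auto simp: space_restrict_space mult.assoc\<close>)
  then show ?thesis by (simp add: log_potential_def T_def L2_inner_def)
qed

text \<open>Every eigenvalue is the Rayleigh quotient of its eigenfunction, hence at most the supremum
of all Rayleigh quotients; the maximizer shows that this supremum is itself an eigenvalue.\<close>
lemma tau1_eq_top_value: "tau1 \<Omega> = top_value"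
  unfolding tau1_def
proof (rule Greatest_equality)
  obtain w where w: "square_integrable (lebesgue_on \<Omega>) w" "\<And>x. x \<in> space (lebesgue_on \<Omega>) \<Longrightarrow> 0 < w x"
      "\<And>x. x \<in> closure \<Omega> \<Longrightarrow> T w x = top_value * w x"
    by (rule positive_continuous_maximizer) (rule that)
  have "\<not> (AE x in lebesgue_on \<Omega>. w x = 0)"
  proof
    assume "AE x in lebesgue_on \<Omega>. w x = 0"
    with AE_space have "AE x in lebesgue_on \<Omega>. False" by eventually_elim (use w(2) in force)
    then show False using nonnull by (simp add: eventually_False ae_filter_eq_bot_iff)
  qed
  moreover have "AE x in lebesgue_on \<Omega>. log_potential \<Omega> w x = top_value * w x"
    using w(3) closure_subset by (intro AE_I2) (auto simp: space_restrict_space log_potential_eq_T)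
  ultimately show "log_potential_eigenvalue \<Omega> top_value"
    using w(1) unfolding log_potential_eigenvalue_def in_L2_def square_integrable_def by blast
next
  fix t assume "log_potential_eigenvalue \<Omega> t"
  then obtain u where u: "square_integrable (lebesgue_on \<Omega>) u" and nz: "\<not> (AE x in lebesgue_on \<Omega>. u x = 0)"
    and ev: "AE x in lebesgue_on \<Omega>. log_potential \<Omega> u x = t * u x"
    unfolding log_potential_eigenvalue_def in_L2_def square_integrable_def by blast
  have "AE x in lebesgue_on \<Omega>. T u x = t * u x"
    using AE_space ev by eventually_elim (simp add: space_restrict_space log_potential_eq_T)
  then have "energy u = L2_inner (lebesgue_on \<Omega>) (\<lambda>x. t * u x) u"
    unfolding energy_def L2_inner_def
    using square_integrable_measurable[OF u] square_integrable_measurable[OF square_integrable_T[OF u]]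
    by (intro integral_cong_AE) auto
  then have "t * L2_inner (lebesgue_on \<Omega>) u u \<le> top_value * L2_inner (lebesgue_on \<Omega>) u u"
    using energy_le_top_value[OF u] by (simp add: L2_inner_cmult_left)
  moreover have "0 < L2_inner (lebesgue_on \<Omega>) u u"
    using L2_inner_self_eq_0_iff[OF u] nz L2_inner_self_nonneg[of "lebesgue_on \<Omega>" u] by linarith
  ultimately show "t \<le> top_value" by simp
qed

end

text \<open>Test functions on the whole plane that live on \<open>\<Omega>\<close>. They are required to be Borel
measurable, so that composing them with a reflection preserves measurability; the continuous
eigenfunction extended by zero is of this kind.\<close>
definition bounded_density :: "(real^2) set \<Rightarrow> (real^2 \<Rightarrow> real) \<Rightarrow> bool" where
  "bounded_density \<Omega> u \<longleftrightarrow> u \<in> borel_measurable borel \<and> (\<forall>x. 0 \<le> u x) \<and> (\<forall>x. x \<notin> \<Omega> \<longrightarrow> u x = 0)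
     \<and> (\<exists>B. \<forall>x. u x \<le> B)"

text \<open>Energies and masses are \<open>ennreal\<close>-valued, so that integrals of nonnegative functions can be
split and substituted freely.\<close>
definition log_energy :: "(real^2 \<Rightarrow> real) \<Rightarrow> ennreal" where
  "log_energy u = (\<integral>\<^sup>+x. \<integral>\<^sup>+y. ennreal (log_kernel x y * u x * u y) \<partial>lborel \<partial>lborel)"

definition square_mass :: "(real^2 \<Rightarrow> real) \<Rightarrow> ennreal" where
  "square_mass u = (\<integral>\<^sup>+x. ennreal ((u x)\<^sup>2) \<partial>lborel)"

context log_domain
begin

lemma bounded_density_square_integrable:
  assumes "bounded_density \<Omega> u"
  shows "square_integrable (lebesgue_on \<Omega>) u"
proof -
  obtain B where "\<And>x. u x \<le> B" using assms by (auto simp: bounded_density_def)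
  then show ?thesis
    using assms by (intro square_integrable_bounded[of _ B] borel_measurable_lebesgue_onI)
      (auto simp: bounded_density_def)
qed

lemma log_energy_eq:
  assumes u: "bounded_density \<Omega> u"
  shows "log_energy u = ennreal (energy u)"
proof -
  note sq = bounded_density_square_integrable[OF u]
  have u0: "0 \<le> u x" and out: "x \<notin> \<Omega> \<Longrightarrow> u x = 0" for x using u by (auto simp: bounded_density_def)
  have drop: "(\<integral>\<^sup>+y. ennreal (f y * u y) \<partial>lebesgue_on \<Omega>) = (\<integral>\<^sup>+y. ennreal (f y * u y) \<partial>lborel)" for f
    unfolding nn_integral_lebesgue_on[OF domain_measurable]
    by (rule nn_integral_cong) (auto simp: out split: split_indicator)
  have T: "ennreal (T u x) = (\<integral>\<^sup>+y. ennreal (log_kernel x y * u y) \<partial>lborel)" if "x \<in> \<Omega>" for x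
  proof -
    have "x \<in> closure \<Omega>" using that closure_subset by blast
    then show ?thesis
      unfolding T_def L2_inner_def drop[symmetric]
      by (intro nn_integral_eq_integral[symmetric] integrable_square_product K_section sq AE_I2)
         (auto intro: mult_nonneg_nonneg log_kernel_nonneg u0)
  qed
  have T0: "0 \<le> T u x" for x
    unfolding T_def L2_inner_def by (intro Bochner_Integration.integral_nonneg mult_nonneg_nonneg log_kernel_nonneg u0)
  have "ennreal (energy u) = (\<integral>\<^sup>+x. ennreal (T u x * u x) \<partial>lebesgue_on \<Omega>)"
    unfolding energy_def L2_inner_def
    by (intro nn_integral_eq_integral[symmetric] integrable_square_product square_integrable_T sq AE_I2)
       (auto intro: mult_nonneg_nonneg T0 u0)
  also have "\<dots> = (\<integral>\<^sup>+x. ennreal (T u x * u x) \<partial>lborel)" by (rule drop)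
  also have "\<dots> = log_energy u"
    unfolding log_energy_def
  proof (rule nn_integral_cong)
    fix x
    show "ennreal (T u x * u x) = (\<integral>\<^sup>+y. ennreal (log_kernel x y * u x * u y) \<partial>lborel)"
    proof (cases "x \<in> \<Omega>")
      case True
      have [measurable]: "u \<in> borel_measurable borel" using u by (simp add: bounded_density_def)
      have "ennreal (T u x * u x) = ennreal (u x) * (\<integral>\<^sup>+y. ennreal (log_kernel x y * u y) \<partial>lborel)"
        by (simp add: ennreal_mult T0 u0 T[OF True] mult.commute)
      also have "\<dots> = (\<integral>\<^sup>+y. ennreal (u x) * ennreal (log_kernel x y * u y) \<partial>lborel)"
        by (rule nn_integral_cmult[symmetric]) measurable
      also have "\<dots> = (\<integral>\<^sup>+y. ennreal (log_kernel x y * u x * u y) \<partial>lborel)"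
        by (intro nn_integral_cong)
           (simp add: ennreal_mult[symmetric] u0 log_kernel_nonneg mult_ac)
      finally show ?thesis .
    qed (simp add: out)
  qed
  finally show ?thesis by simp
qed

lemma square_mass_eq:
  assumes u: "bounded_density \<Omega> u"
  shows "square_mass u = ennreal (L2_inner (lebesgue_on \<Omega>) u u)"
proof -
  note sq = bounded_density_square_integrable[OF u]
  have "ennreal (L2_inner (lebesgue_on \<Omega>) u u) = (\<integral>\<^sup>+x. ennreal (u x * u x) \<partial>lebesgue_on \<Omega>)"
    unfolding L2_inner_def by (intro nn_integral_eq_integral[symmetric] integrable_square_product sq AE_I2) simp
  also have "\<dots> = square_mass u"
    unfolding nn_integral_lebesgue_on[OF domain_measurable] square_mass_def
    using u by (intro nn_integral_cong) (auto simp: bounded_density_def power2_eq_square split: split_indicator)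
  finally show ?thesis by simp
qed

lemma log_energy_le_tau1:
  assumes "bounded_density \<Omega> u"
  shows "log_energy u \<le> ennreal (tau1 \<Omega>) * square_mass u"
  unfolding log_energy_eq[OF assms] square_mass_eq[OF assms] tau1_eq_top_value
  using energy_le_top_value[OF bounded_density_square_integrable[OF assms]] top_value_pos
  by (simp add: ennreal_mult[symmetric] L2_inner_self_nonneg ennreal_leI)

lemma positive_eigenfunction:
  obtains w where "bounded_density \<Omega> w" "\<And>x. x \<in> \<Omega> \<Longrightarrow> 0 < w x"
    "log_energy w = ennreal (tau1 \<Omega>) * square_mass w" "0 < square_mass w" "square_mass w < \<infinity>"
proof -
  obtain v where v: "continuous_on (closure \<Omega>) v" "square_integrable (lebesgue_on \<Omega>) v"
    "\<And>x. x \<in> \<Omega> \<Longrightarrow> 0 < v x" "\<And>x. x \<in> closure \<Omega> \<Longrightarrow> T v x = top_value * v x"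
    using positive_continuous_maximizer by (auto simp: space_restrict_space)
  define w where "w = (\<lambda>x. if x \<in> \<Omega> then v x else 0)"
  have wv: "w x = v x" if "x \<in> space (lebesgue_on \<Omega>)" for x
    using that by (simp add: w_def space_restrict_space)
  have w_dens: "bounded_density \<Omega> w"
    unfolding bounded_density_def
  proof (intro conjI)
    have "continuous_on \<Omega> v" using v(1) closure_subset by (rule continuous_on_subset)
    then have "v \<in> borel_measurable (restrict_space borel \<Omega>)" by (rule borel_measurable_continuous_on_restrict)
    then have "(\<lambda>x. indicator \<Omega> x *\<^sub>R v x) \<in> borel_measurable borel"
      using open_domain by (subst (asm) borel_measurable_restrict_space_iff) auto
    moreover have "w = (\<lambda>x. indicator \<Omega> x *\<^sub>R v x)" by (auto simp: w_def)
    ultimately show "w \<in> borel_measurable borel" by simp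
    have "compact (v ` closure \<Omega>)" by (rule compact_continuous_image[OF v(1) compact_S])
    then obtain B where B: "\<And>x. x \<in> closure \<Omega> \<Longrightarrow> norm (v x) \<le> B"
      by (meson bounded_iff compact_imp_bounded imageI)
    have "w x \<le> max B 0" for x
      using B[of x] closure_subset[of \<Omega>] by (auto simp: w_def)
    then show "\<exists>B. \<forall>x. w x \<le> B" by blast
  qed (use v(3) in \<open>auto simp: w_def less_imp_le\<close>)
  note sq = bounded_density_square_integrable[OF w_dens]
  have T: "T w = T v"
    unfolding T_def[abs_def] L2_inner_def using wv by (intro ext Bochner_Integration.integral_cong) auto
  have en: "energy w = top_value * L2_inner (lebesgue_on \<Omega>) w w"
  proof -
    have "energy w = L2_inner (lebesgue_on \<Omega>) (\<lambda>x. top_value * w x) w"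
      unfolding energy_def L2_inner_def T
      using v(4) closure_subset[of \<Omega>] by (intro Bochner_Integration.integral_cong) (auto simp: w_def)
    then show ?thesis by (simp add: L2_inner_cmult_left)
  qed
  show ?thesis
  proof
    show "bounded_density \<Omega> w" by (rule w_dens)
    show "0 < w x" if "x \<in> \<Omega>" for x using v(3) that by (simp add: w_def)
    show "log_energy w = ennreal (tau1 \<Omega>) * square_mass w"
      unfolding log_energy_eq[OF w_dens] square_mass_eq[OF w_dens] tau1_eq_top_value
      using top_value_pos by (simp add: en ennreal_mult L2_inner_self_nonneg)
    have "\<not> (AE x in lebesgue_on \<Omega>. w x = 0)"
    proof
      assume "AE x in lebesgue_on \<Omega>. w x = 0"
      with AE_space have "AE x in lebesgue_on \<Omega>. False"
        by eventually_elim (use v(3) wv in \<open>force simp: space_restrict_space\<close>)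
      then show False using nonnull by (simp add: eventually_False ae_filter_eq_bot_iff)
    qed
    then show "0 < square_mass w"
      using L2_inner_self_eq_0_iff[OF sq] L2_inner_self_nonneg[of "lebesgue_on \<Omega>" w]
      by (simp add: square_mass_eq[OF w_dens])
    show "square_mass w < \<infinity>" by (simp add: square_mass_eq[OF w_dens])
  qed
qed

end

section \<open>Reflections and two-point rearrangement\<close>
lemma AE_eq_of_nn_integral_eq:
  assumes [measurable]: "f \<in> borel_measurable M" "g \<in> borel_measurable M"
    and le: "AE x in M. f x \<le> g x" and eq: "(\<integral>\<^sup>+x. f x \<partial>M) = (\<integral>\<^sup>+x. g x \<partial>M)"
    and fin: "(\<integral>\<^sup>+x. f x \<partial>M) \<noteq> \<infinity>"
  shows "AE x in M. f x = g x"
proof -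
  have "(\<integral>\<^sup>+x. g x - f x \<partial>M) = (\<integral>\<^sup>+x. g x \<partial>M) - (\<integral>\<^sup>+x. f x \<partial>M)"
    by (rule nn_integral_diff) (use fin le in auto)
  also have "\<dots> = 0" using eq fin by simp
  finally have "AE x in M. g x - f x = 0" by (subst (asm) nn_integral_0_iff_AE) auto
  with le show ?thesis by eventually_elim (auto simp: ennreal_minus_eq_0 intro: antisym)
qed

text \<open>The sum of all four products is unchanged by sorting, while sorting both pairs in the same
order increases \<open>p r + p' r'\<close> by \<open>d \<ge> 0\<close>; so weight \<open>d\<close> moves from the smaller coefficient
to the larger one.\<close>
lemma rearrangement_two_points:
  fixes k l :: real
  assumes "l \<le> k"
  shows "k * (p * r + p' * r') + l * (p * r' + p' * r)
    \<le> k * (max p p' * max r r' + min p p' * min r r') + l * (max p p' * min r r' + min p p' * max r r')"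
proof -
  define d where "d = max p p' * max r r' + min p p' * min r r' - (p * r + p' * r')"
  have d: "0 \<le> d"
  proof (cases "p \<le> p'"; cases "r \<le> r'")
    assume h: "p \<le> p'" "\<not> r \<le> r'"
    have "0 \<le> (p' - p) * (r - r')" using h by (intro mult_nonneg_nonneg) auto
    then show ?thesis using h by (simp add: d_def max_def min_def algebra_simps)
  next
    assume h: "\<not> p \<le> p'" "r \<le> r'"
    have "0 \<le> (p - p') * (r' - r)" using h by (intro mult_nonneg_nonneg) auto
    then show ?thesis using h by (simp add: d_def max_def min_def algebra_simps)
  qed (auto simp: d_def max_def min_def)
  have mm: "max p p' * min r r' + min p p' * max r r' = p * r' + p' * r - d"
    by (auto simp: d_def max_def min_def algebra_simps)
  have "l * d \<le> k * d" using assms d by (rule mult_right_mono)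
  then have "k * (p * r + p' * r') + l * (p * r' + p' * r)
      \<le> k * (p * r + p' * r' + d) + l * (p * r' + p' * r - d)"
    by (simp add: algebra_simps)
  also have "p * r + p' * r' + d = max p p' * max r r' + min p p' * min r r'" by (simp add: d_def)
  finally show ?thesis by (simp only: mm)
qed

locale halfspace_reflection =
  fixes a :: "real^2" and b :: real
  assumes normal_nonzero: "a \<noteq> 0"
begin

definition H :: "(real^2) set" where "H = {x. a \<bullet> x < b}"

definition \<sigma> :: "real^2 \<Rightarrow> real^2" where "\<sigma> x = x - (2 * (a \<bullet> x - b) / (a \<bullet> a)) *\<^sub>R a"

lemma reflection_eq: "reflection H = \<sigma>"
  unfolding H_def using reflection_halfspace[OF normal_nonzero, of b] by (auto simp: \<sigma>_def)

lemma H_iff: "x \<in> H \<longleftrightarrow> a \<bullet> x - b < 0"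
  by (simp add: H_def)

lemma side_\<sigma>: "a \<bullet> \<sigma> x - b = - (a \<bullet> x - b)"
  using normal_nonzero by (simp add: \<sigma>_def inner_diff_right)

lemma \<sigma>_\<sigma> [simp]: "\<sigma> (\<sigma> x) = x"
proof -
  have "\<sigma> (\<sigma> x) = \<sigma> x - (2 * (a \<bullet> \<sigma> x - b) / (a \<bullet> a)) *\<^sub>R a" by (rule \<sigma>_def)
  also have "\<dots> = \<sigma> x + (2 * (a \<bullet> x - b) / (a \<bullet> a)) *\<^sub>R a"
    by (simp only: side_\<sigma> mult_minus_right minus_divide_left[symmetric] scaleR_minus_left diff_minus_eq_add)
  also have "\<dots> = x" by (simp add: \<sigma>_def)
  finally show ?thesis .
qed

lemma \<sigma>_fixed: "a \<bullet> x - b = 0 \<Longrightarrow> \<sigma> x = x"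
  by (simp add: \<sigma>_def)

lemma image_\<sigma>: "\<sigma> ` A = \<sigma> -` A"
  by (force intro: image_eqI[where x = "\<sigma> _"])

text \<open>Everything geometric about the reflection follows from this identity: reflecting one point
increases the distance exactly when both points lie strictly on the same side, because the
product of the signed distances to the boundary line is then positive.\<close>
lemma norm_reflected_square:
  "(norm (x - \<sigma> y))\<^sup>2 = (norm (x - y))\<^sup>2 + 4 * ((a \<bullet> x - b) * (a \<bullet> y - b)) / (a \<bullet> a)"
proof -
  define t where "t = 2 * (a \<bullet> y - b) / (a \<bullet> a)"
  have aa: "a \<bullet> a \<noteq> 0" using normal_nonzero by simp
  have expand: "(norm (z + t *\<^sub>R a))\<^sup>2 = (norm z)\<^sup>2 + 2 * t * (a \<bullet> z) + t * (t * (a \<bullet> a))" for z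
    by (simp add: power2_norm_eq_inner inner_add_left inner_add_right inner_commute algebra_simps)
  have "x - \<sigma> y = (x - y) + t *\<^sub>R a" by (simp add: \<sigma>_def t_def)
  then have "(norm (x - \<sigma> y))\<^sup>2 = (norm (x - y))\<^sup>2 + 2 * t * (a \<bullet> x - a \<bullet> y) + t * (t * (a \<bullet> a))"
    by (simp only: expand inner_diff_right)
  also have "t * (a \<bullet> a) = 2 * (a \<bullet> y - b)" using aa by (simp add: t_def)
  also have "t * (2 * (a \<bullet> y - b)) = 2 * t * (a \<bullet> y - b)" by (simp only: mult_ac)
  also have "(norm (x - y))\<^sup>2 + 2 * t * (a \<bullet> x - a \<bullet> y) + 2 * t * (a \<bullet> y - b)
      = (norm (x - y))\<^sup>2 + 2 * t * (a \<bullet> x - b)"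
    by (simp add: algebra_simps)
  also have "2 * t * (a \<bullet> x - b) = 4 * ((a \<bullet> x - b) * (a \<bullet> y - b)) / (a \<bullet> a)"
    by (simp add: t_def)
  finally show ?thesis .
qed

lemma norm_\<sigma>_diff: "norm (\<sigma> x - \<sigma> y) = norm (x - y)"
proof -
  have "(norm (\<sigma> x - \<sigma> y))\<^sup>2 = (norm (\<sigma> x - y))\<^sup>2 + 4 * ((a \<bullet> \<sigma> x - b) * (a \<bullet> y - b)) / (a \<bullet> a)"
    by (rule norm_reflected_square)
  also have "norm (\<sigma> x - y) = norm (y - \<sigma> x)" by (rule norm_minus_commute)
  also have "(norm (y - \<sigma> x))\<^sup>2 = (norm (y - x))\<^sup>2 + 4 * ((a \<bullet> y - b) * (a \<bullet> x - b)) / (a \<bullet> a)"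
    by (rule norm_reflected_square)
  also have "\<dots> + 4 * ((a \<bullet> \<sigma> x - b) * (a \<bullet> y - b)) / (a \<bullet> a) = (norm (x - y))\<^sup>2"
  proof -
    have "A + 4 * (p * q) / c + 4 * (- q * p) / c = A" for A p q c :: real by (simp add: mult.commute)
    then show ?thesis unfolding side_\<sigma> by (simp only: norm_minus_commute)
  qed
  finally show ?thesis by simp
qed

lemma norm_\<sigma>_swap: "norm (\<sigma> x - y) = norm (x - \<sigma> y)"
  using norm_\<sigma>_diff[of x "\<sigma> y"] by simp

lemma norm_le_reflected:
  assumes "0 \<le> (a \<bullet> x - b) * (a \<bullet> y - b)"
  shows "norm (x - y) \<le> norm (x - \<sigma> y)"
proof -
  have "(norm (x - y))\<^sup>2 \<le> (norm (x - \<sigma> y))\<^sup>2"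
    unfolding norm_reflected_square using assms by simp
  then show ?thesis by simp
qed

lemma norm_less_reflected:
  assumes "0 < (a \<bullet> x - b) * (a \<bullet> y - b)"
  shows "norm (x - y) < norm (x - \<sigma> y)"
proof -
  have "(norm (x - y))\<^sup>2 < (norm (x - \<sigma> y))\<^sup>2"
    unfolding norm_reflected_square using assms normal_nonzero by simp
  then show ?thesis by (rule power2_less_imp_less) simp
qed

lemma continuous_\<sigma>: "continuous_on A \<sigma>"
  unfolding \<sigma>_def by (intro continuous_intros) (use normal_nonzero in auto)

lemma \<sigma>_measurable [measurable]: "\<sigma> \<in> borel_measurable borel"
  by (rule borel_measurable_continuous_onI[OF continuous_\<sigma>])

lemma H_measurable [measurable]: "H \<in> sets borel"
  unfolding H_def by (intro borel_open open_halfspace_lt)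

text \<open>A reflection is a linear isometry followed by a translation.\<close>
lemma lborel_distr_\<sigma>: "distr lborel borel \<sigma> = lborel"
proof (rule lborel_eqI[symmetric])
  fix l u :: "real^2"
  assume lu: "\<And>i. i \<in> Basis \<Longrightarrow> l \<bullet> i \<le> u \<bullet> i"
  define R where "R = (\<lambda>x. x - (2 * (a \<bullet> x) / (a \<bullet> a)) *\<^sub>R a)"
  define c where "c = (2 * b / (a \<bullet> a)) *\<^sub>R a"
  have \<sigma>_R: "\<sigma> x = c + R x" for x
    by (simp add: \<sigma>_def R_def c_def algebra_simps diff_divide_distrib)
  have R_\<sigma>: "R x = \<sigma> x - \<sigma> 0" for x by (simp add: \<sigma>_R R_def)
  have lin: "linear R"
    unfolding R_def by (rule linearI) (simp_all add: inner_add_right algebra_simps add_divide_distrib)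
  have orth: "orthogonal_transformation R"
    unfolding orthogonal_transformation using lin norm_\<sigma>_diff[of _ 0] by (simp add: R_\<sigma>)
  have img: "\<sigma> -` box l u = (+) c ` R ` box l u"
    unfolding image_\<sigma>[symmetric] image_image by (simp add: \<sigma>_R)
  have lm: "R ` box l u \<in> lmeasurable" and m: "measure lebesgue (R ` box l u) = measure lebesgue (box l u)"
    using measurable_orthogonal_image[OF orth] measure_orthogonal_image[OF orth] by auto
  have lm2: "\<sigma> -` box l u \<in> lmeasurable" unfolding img by (rule measurable_translation[OF lm])
  have op: "\<sigma> -` box l u \<in> sets borel"
    by (intro borel_open open_vimage open_box continuous_\<sigma>)
  have "emeasure (distr lborel borel \<sigma>) (box l u) = emeasure lborel (\<sigma> -` box l u)"
    by (subst emeasure_distr) auto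
  also have "\<dots> = emeasure lebesgue (\<sigma> -` box l u)" using op by simp
  also have "\<dots> = ennreal (measure lebesgue (\<sigma> -` box l u))"
    by (rule emeasure_eq_measure2[OF lm2])
  also have "measure lebesgue (\<sigma> -` box l u) = measure lebesgue (box l u)"
    unfolding img by (simp add: measure_translation m)
  also have "ennreal \<dots> = emeasure lborel (box l u)"
    by (simp add: emeasure_eq_measure2[symmetric])
  also have "\<dots> = (\<Prod>b\<in>Basis. (u - l) \<bullet> b)" using lu by simp
  finally show "emeasure (distr lborel borel \<sigma>) (box l u) = (\<Prod>b\<in>Basis. (u - l) \<bullet> b)" .
qed simp

lemma nn_integral_\<sigma>:
  assumes "f \<in> borel_measurable borel"
  shows "(\<integral>\<^sup>+x. f (\<sigma> x) \<partial>lborel) = (\<integral>\<^sup>+x. f x \<partial>lborel)"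
proof -
  have "(\<integral>\<^sup>+x. f x \<partial>lborel) = (\<integral>\<^sup>+x. f x \<partial>distr lborel borel \<sigma>)" by (simp add: lborel_distr_\<sigma>)
  also have "\<dots> = (\<integral>\<^sup>+x. f (\<sigma> x) \<partial>lborel)" by (rule nn_integral_distr) (use assms in auto)
  finally show ?thesis by simp
qed

lemma AE_\<sigma>:
  assumes "AE x in lborel. P x"
  shows "AE x in lborel. P (\<sigma> x)"
proof -
  have "AE x in distr lborel borel \<sigma>. P x" unfolding lborel_distr_\<sigma> by (rule assms)
  then show ?thesis by (rule AE_distrD[rotated]) simp
qed

text \<open>The polarization of a function: on each pair of mirror points, the larger value goes to \<open>H\<close>.\<close>
definition pol :: "(real^2 \<Rightarrow> real) \<Rightarrow> real^2 \<Rightarrow> real" where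
  "pol u x = (if x \<in> H then max (u x) (u (\<sigma> x)) else min (u x) (u (\<sigma> x)))"

lemma pol_measurable: "u \<in> borel_measurable borel \<Longrightarrow> pol u \<in> borel_measurable borel"
proof -
  assume [measurable]: "u \<in> borel_measurable borel"
  show "pol u \<in> borel_measurable borel" unfolding pol_def[abs_def] by measurable
qed

lemma pol_neg_side:
  assumes "a \<bullet> x - b < 0"
  shows "pol u x = max (u x) (u (\<sigma> x))" "pol u (\<sigma> x) = min (u x) (u (\<sigma> x))"
  using assms side_\<sigma>[of x] by (auto simp: pol_def H_iff min.commute)

text \<open>The boundary line can be counted with the far side because a point on it is its own mirror
image, where maximum and minimum coincide.\<close>
lemma pol_nonneg_side:
  assumes "0 \<le> a \<bullet> x - b"
  shows "pol u x = min (u x) (u (\<sigma> x))" "pol u (\<sigma> x) = max (u x) (u (\<sigma> x))"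
proof -
  show "pol u x = min (u x) (u (\<sigma> x))" using assms by (simp add: pol_def H_iff)
  show "pol u (\<sigma> x) = max (u x) (u (\<sigma> x))"
  proof (cases "a \<bullet> x - b = 0")
    case True
    then show ?thesis by (simp add: \<sigma>_fixed pol_def)
  next
    case False
    then have "\<sigma> x \<in> H" using assms side_\<sigma>[of x] by (simp add: H_iff)
    then show ?thesis by (simp add: pol_def max.commute)
  qed
qed

lemma square_mass_pol:
  assumes u[measurable]: "u \<in> borel_measurable borel"
  shows "square_mass (pol u) = square_mass u"
proof -
  have sum: "2 * square_mass v = (\<integral>\<^sup>+x. ennreal ((v x)\<^sup>2 + (v (\<sigma> x))\<^sup>2) \<partial>lborel)"
    if [measurable]: "v \<in> borel_measurable borel" for v
  proof -
    have "2 * square_mass v = (\<integral>\<^sup>+x. ennreal ((v x)\<^sup>2) \<partial>lborel) + (\<integral>\<^sup>+x. ennreal ((v (\<sigma> x))\<^sup>2) \<partial>lborel)"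
      using nn_integral_\<sigma>[of "\<lambda>x. ennreal ((v x)\<^sup>2)"] by (simp add: square_mass_def mult_2)
    also have "\<dots> = (\<integral>\<^sup>+x. ennreal ((v x)\<^sup>2) + ennreal ((v (\<sigma> x))\<^sup>2) \<partial>lborel)"
      by (rule nn_integral_add[symmetric]) auto
    finally show ?thesis by simp
  qed
  have "(pol u x)\<^sup>2 + (pol u (\<sigma> x))\<^sup>2 = (u x)\<^sup>2 + (u (\<sigma> x))\<^sup>2" for x
    using pol_neg_side[of x u] pol_nonneg_side[of x u]
    by (cases "a \<bullet> x - b < 0") (auto simp: max_def min_def)
  then have "2 * square_mass (pol u) = 2 * square_mass u"
    by (simp add: sum u pol_measurable)
  then show ?thesis by (simp add: ennreal_mult_cancel_left)
qed

text \<open>The energy integrand summed over the four pairs obtained by reflecting either variable.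
Integrating it gives four times the energy, and it groups the values of \<open>u\<close> at the mirror
pairs of \<open>x\<close> and \<open>y\<close> into a form to which the two-point rearrangement applies.\<close>
definition reflected_energy_density :: "(real^2 \<Rightarrow> real) \<Rightarrow> real^2 \<Rightarrow> real^2 \<Rightarrow> real" where
  "reflected_energy_density u x y =
     log_kernel x y * (u x * u y + u (\<sigma> x) * u (\<sigma> y))
   + log_kernel x (\<sigma> y) * (u x * u (\<sigma> y) + u (\<sigma> x) * u y)"

lemma log_kernel_\<sigma>: "log_kernel (\<sigma> x) (\<sigma> y) = log_kernel x y" "log_kernel (\<sigma> x) y = log_kernel x (\<sigma> y)"
  by (simp_all add: log_kernel_def norm_\<sigma>_diff norm_\<sigma>_swap)

lemma log_energy_reflected:
  assumes [measurable]: "u \<in> borel_measurable borel" and nonneg: "\<And>x. 0 \<le> u x"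
  shows "4 * log_energy u = (\<integral>\<^sup>+x. \<integral>\<^sup>+y. ennreal (reflected_energy_density u x y) \<partial>lborel \<partial>lborel)"
proof -
  define F where "F = (\<lambda>x y. ennreal (log_kernel x y * u x * u y))"
  have [measurable]: "(\<lambda>z. F (f z) (g z)) \<in> borel_measurable N"
    if [measurable]: "f \<in> borel_measurable N" "g \<in> borel_measurable N" for f g :: "'b \<Rightarrow> real^2" and N :: "'b measure"
    unfolding F_def by measurable
  have e1: "log_energy u = (\<integral>\<^sup>+x. \<integral>\<^sup>+y. F x y \<partial>lborel \<partial>lborel)" by (simp add: log_energy_def F_def)
  have e2: "log_energy u = (\<integral>\<^sup>+x. \<integral>\<^sup>+y. F x (\<sigma> y) \<partial>lborel \<partial>lborel)"
    unfolding e1 by (intro nn_integral_cong nn_integral_\<sigma>[symmetric]) measurable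
  have e3: "log_energy u = (\<integral>\<^sup>+x. \<integral>\<^sup>+y. F (\<sigma> x) y \<partial>lborel \<partial>lborel)"
    unfolding e1 by (rule nn_integral_\<sigma>[symmetric]) measurable
  have e4: "log_energy u = (\<integral>\<^sup>+x. \<integral>\<^sup>+y. F (\<sigma> x) (\<sigma> y) \<partial>lborel \<partial>lborel)"
    unfolding e2 by (rule nn_integral_\<sigma>[symmetric]) measurable
  have "4 * log_energy u = (log_energy u + log_energy u) + (log_energy u + log_energy u)"
    by (simp add: mult_2[symmetric] mult.assoc[symmetric])
  also have "\<dots> = ((\<integral>\<^sup>+x. \<integral>\<^sup>+y. F x y \<partial>lborel \<partial>lborel) + (\<integral>\<^sup>+x. \<integral>\<^sup>+y. F (\<sigma> x) (\<sigma> y) \<partial>lborel \<partial>lborel))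
      + ((\<integral>\<^sup>+x. \<integral>\<^sup>+y. F x (\<sigma> y) \<partial>lborel \<partial>lborel) + (\<integral>\<^sup>+x. \<integral>\<^sup>+y. F (\<sigma> x) y \<partial>lborel \<partial>lborel))"
    using e1 e2 e3 e4 by simp
  also have "\<dots> = (\<integral>\<^sup>+x. \<integral>\<^sup>+y. (F x y + F (\<sigma> x) (\<sigma> y)) + (F x (\<sigma> y) + F (\<sigma> x) y) \<partial>lborel \<partial>lborel)"
    by (simp add: nn_integral_add)
  also have "\<dots> = (\<integral>\<^sup>+x. \<integral>\<^sup>+y. ennreal (reflected_energy_density u x y) \<partial>lborel \<partial>lborel)"
  proof (intro nn_integral_cong)
    fix x y
    have "(F x y + F (\<sigma> x) (\<sigma> y)) + (F x (\<sigma> y) + F (\<sigma> x) y)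
        = ennreal ((log_kernel x y * u x * u y + log_kernel x y * u (\<sigma> x) * u (\<sigma> y))
          + (log_kernel x (\<sigma> y) * u x * u (\<sigma> y) + log_kernel x (\<sigma> y) * u (\<sigma> x) * u y))"
      unfolding F_def log_kernel_\<sigma>
      by (simp add: ennreal_plus[symmetric] nonneg log_kernel_nonneg del: ennreal_plus)
    then show "(F x y + F (\<sigma> x) (\<sigma> y)) + (F x (\<sigma> y) + F (\<sigma> x) y) = ennreal (reflected_energy_density u x y)"
      by (simp add: reflected_energy_density_def algebra_simps)
  qed
  finally show ?thesis .
qed

text \<open>If \<open>x\<close> and \<open>y\<close> are on the same side, then \<open>K x y\<close> is the larger of the two kernel values and
\<open>pol\<close> sorts both mirror pairs in the same order; on opposite sides both relations are
reversed. The two excluded points of \<open>y\<close> are those where one of the kernel values is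
evaluated on the diagonal.\<close>
lemma reflected_energy_density_pol_le:
  assumes "y \<noteq> x" "y \<noteq> \<sigma> x"
  shows "reflected_energy_density u x y \<le> reflected_energy_density (pol u) x y"
proof -
  let ?k = "log_kernel x y" and ?l = "log_kernel x (\<sigma> y)"
  have x\<sigma>y: "x \<noteq> \<sigma> y" using assms(2) by auto
  have same: "?l \<le> ?k" if "0 \<le> (a \<bullet> x - b) * (a \<bullet> y - b)"
    using log_kernel_antimono[OF _ norm_le_reflected[OF that]] assms(1) by auto
  have opposite: "?k \<le> ?l" if "(a \<bullet> x - b) * (a \<bullet> y - b) \<le> 0"
  proof -
    have "norm (x - \<sigma> y) \<le> norm (x - \<sigma> (\<sigma> y))"
      by (rule norm_le_reflected) (use that in \<open>simp only: side_\<sigma> mult_minus_right neg_0_le_iff_le\<close>)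
    then show ?thesis using log_kernel_antimono[OF x\<sigma>y, of x y] by simp
  qed
  have lk: ?thesis if "?l \<le> ?k" and
    "pol u x = max (u x) (u (\<sigma> x)) \<and> pol u (\<sigma> x) = min (u x) (u (\<sigma> x)) \<and>
     pol u y = max (u y) (u (\<sigma> y)) \<and> pol u (\<sigma> y) = min (u y) (u (\<sigma> y)) \<or>
     pol u x = min (u x) (u (\<sigma> x)) \<and> pol u (\<sigma> x) = max (u x) (u (\<sigma> x)) \<and>
     pol u y = min (u y) (u (\<sigma> y)) \<and> pol u (\<sigma> y) = max (u y) (u (\<sigma> y))"
    using rearrangement_two_points[OF that(1), of "u x" "u y" "u (\<sigma> x)" "u (\<sigma> y)"] that(2)
    unfolding reflected_energy_density_def by (elim disjE conjE) (simp_all add: add.commute)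
  have kl: ?thesis if "?k \<le> ?l" and
    "pol u x = max (u x) (u (\<sigma> x)) \<and> pol u (\<sigma> x) = min (u x) (u (\<sigma> x)) \<and>
     pol u y = min (u y) (u (\<sigma> y)) \<and> pol u (\<sigma> y) = max (u y) (u (\<sigma> y)) \<or>
     pol u x = min (u x) (u (\<sigma> x)) \<and> pol u (\<sigma> x) = max (u x) (u (\<sigma> x)) \<and>
     pol u y = max (u y) (u (\<sigma> y)) \<and> pol u (\<sigma> y) = min (u y) (u (\<sigma> y))"
    using rearrangement_two_points[OF that(1), of "u x" "u (\<sigma> y)" "u (\<sigma> x)" "u y"] that(2)
    unfolding reflected_energy_density_def
    by (elim disjE conjE) (simp_all add: add.commute max.commute min.commute)
  show ?thesis
  proof (cases "a \<bullet> x - b < 0"; cases "a \<bullet> y - b < 0")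
    assume s: "a \<bullet> x - b < 0" "a \<bullet> y - b < 0"
    then have "0 \<le> (a \<bullet> x - b) * (a \<bullet> y - b)" by (intro mult_nonpos_nonpos) auto
    then show ?thesis using lk[OF same] pol_neg_side[OF s(1)] pol_neg_side[OF s(2)] by blast
  next
    assume s: "a \<bullet> x - b < 0" "\<not> a \<bullet> y - b < 0"
    then have "(a \<bullet> x - b) * (a \<bullet> y - b) \<le> 0" by (intro mult_nonpos_nonneg) auto
    then show ?thesis using kl[OF opposite] pol_neg_side[OF s(1)] pol_nonneg_side[of y] s(2) by force
  next
    assume s: "\<not> a \<bullet> x - b < 0" "a \<bullet> y - b < 0"
    then have "(a \<bullet> x - b) * (a \<bullet> y - b) \<le> 0" by (intro mult_nonneg_nonpos) auto
    then show ?thesis using kl[OF opposite] pol_neg_side[OF s(2)] pol_nonneg_side[of x] s(1) by force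
  next
    assume s: "\<not> a \<bullet> x - b < 0" "\<not> a \<bullet> y - b < 0"
    then have "0 \<le> (a \<bullet> x - b) * (a \<bullet> y - b)" by (intro mult_nonneg_nonneg) auto
    then show ?thesis using lk[OF same] pol_nonneg_side[of x] pol_nonneg_side[of y] s by force
  qed
qed

lemma AE_reflected_energy_density_pol_le:
  "AE y in lborel. ennreal (reflected_energy_density u x y) \<le> ennreal (reflected_energy_density (pol u) x y)"
  using AE_lborel_singleton[of x] AE_lborel_singleton[of "\<sigma> x"]
  by eventually_elim (intro ennreal_leI reflected_energy_density_pol_le)

lemma reflected_energy_density_measurable:
  assumes [measurable]: "u \<in> borel_measurable borel"
  shows "(\<lambda>x. \<integral>\<^sup>+y. ennreal (reflected_energy_density u x y) \<partial>lborel) \<in> borel_measurable lborel"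
    and "(\<lambda>y. ennreal (reflected_energy_density u x y)) \<in> borel_measurable lborel"
  unfolding reflected_energy_density_def by measurable

lemma
  assumes u: "u \<in> borel_measurable borel" and nonneg: "\<And>x. 0 \<le> u x"
  shows log_energy_pol_ge: "log_energy u \<le> log_energy (pol u)"
    and log_energy_pol_eqD: "log_energy (pol u) = log_energy u \<Longrightarrow> log_energy u < \<infinity> \<Longrightarrow>
      AE x in lborel. AE y in lborel. reflected_energy_density u x y = reflected_energy_density (pol u) x y"
proof -
  have pnn: "0 \<le> pol u x" for x using nonneg by (auto simp: pol_def le_max_iff_disj)
  let ?I = "\<lambda>u x. \<integral>\<^sup>+y. ennreal (reflected_energy_density u x y) \<partial>lborel"
  have E: "4 * log_energy u = (\<integral>\<^sup>+x. ?I u x \<partial>lborel)"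
    and E': "4 * log_energy (pol u) = (\<integral>\<^sup>+x. ?I (pol u) x \<partial>lborel)"
    using log_energy_reflected[OF u nonneg] log_energy_reflected[OF pol_measurable[OF u] pnn] .
  have I_le: "?I u x \<le> ?I (pol u) x" for x
    by (rule nn_integral_mono_AE) (rule AE_reflected_energy_density_pol_le)
  have "4 * log_energy u \<le> 4 * log_energy (pol u)"
    unfolding E E' by (rule nn_integral_mono) (rule I_le)
  then show "log_energy u \<le> log_energy (pol u)"
    by (subst (asm) ennreal_mult_le_mult_iff) auto
  assume eq: "log_energy (pol u) = log_energy u" and fin: "log_energy u < \<infinity>"
  have finI: "(\<integral>\<^sup>+x. ?I u x \<partial>lborel) \<noteq> \<infinity>"
    unfolding E[symmetric] using fin by (simp add: ennreal_mult_eq_top_iff less_top)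
  have "AE x in lborel. ?I u x = ?I (pol u) x"
    by (rule AE_eq_of_nn_integral_eq[OF reflected_energy_density_measurable(1)[OF u]
          reflected_energy_density_measurable(1)[OF pol_measurable[OF u]]])
       (use I_le finI in \<open>auto simp: E[symmetric] E'[symmetric] eq\<close>)
  moreover have "AE x in lborel. ?I u x \<noteq> \<infinity>"
    by (rule nn_integral_PInf_AE[OF reflected_energy_density_measurable(1)[OF u] finI])
  ultimately show "AE x in lborel. AE y in lborel.
      reflected_energy_density u x y = reflected_energy_density (pol u) x y"
  proof eventually_elim
    case (elim x)
    have "AE y in lborel. ennreal (reflected_energy_density u x y) = ennreal (reflected_energy_density (pol u) x y)"
      by (rule AE_eq_of_nn_integral_eq[OF reflected_energy_density_measurable(2)[OF u]
            reflected_energy_density_measurable(2)[OF pol_measurable[OF u]]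
            AE_reflected_energy_density_pol_le elim])
    moreover have "0 \<le> reflected_energy_density v x y" if "\<And>z. 0 \<le> v z" for v y
      unfolding reflected_energy_density_def using that log_kernel_nonneg by simp
    ultimately show ?case using nonneg pnn by simp
  qed
qed

end

section \<open>Polarization of the domain\<close>
lemma ae_eq_setI:
  assumes [measurable]: "A \<in> sets borel" "B \<in> sets borel" and ae: "AE x in lborel. x \<in> A \<longleftrightarrow> x \<in> B"
  shows "A \<cong>\<^sub>a\<^sub>e (B :: 'a::euclidean_space set)"
proof -
  have "sym_diff A B \<in> sets lborel" by simp
  moreover have "AE x in lborel. x \<notin> sym_diff A B" using ae by eventually_elim auto
  ultimately have "sym_diff A B \<in> null_sets lborel" by (simp add: AE_iff_null_sets)
  then show ?thesis unfolding ae_eq_set_def by (rule null_sets_completionI)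
qed

locale polarized_domain = halfspace_reflection a b + log_domain \<Omega>
  for a :: "real^2" and b :: real and \<Omega> :: "(real^2) set"
begin

lemma polarization_iff:
  "x \<in> polarization H \<Omega> \<longleftrightarrow> x \<in> H \<and> (x \<in> \<Omega> \<or> \<sigma> x \<in> \<Omega>) \<or> x \<in> \<Omega> \<and> \<sigma> x \<in> \<Omega>"
  unfolding polarization_def reflection_eq image_\<sigma> by auto

lemma open_polarization: "open (polarization H \<Omega>)"
proof -
  have "open (\<sigma> ` \<Omega>)"
    unfolding image_\<sigma> by (rule open_vimage[OF open_domain continuous_\<sigma>])
  moreover have "open H" unfolding H_def by (rule open_halfspace_lt)
  ultimately show ?thesis
    unfolding polarization_def reflection_eq using open_domain by (intro open_Un open_Int)
qed

lemma polarization_nonempty: "polarization H \<Omega> \<noteq> {}"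
proof -
  obtain x where x: "x \<in> \<Omega>" using domain_nonempty by blast
  consider "a \<bullet> x - b < 0" | "a \<bullet> x - b = 0" | "a \<bullet> \<sigma> x - b < 0"
    using side_\<sigma>[of x] by linarith
  then show ?thesis
  proof cases
    case 1
    then have "x \<in> polarization H \<Omega>" using x by (simp add: polarization_iff H_iff)
    then show ?thesis by blast
  next
    case 2
    then have "x \<in> polarization H \<Omega>" using x \<sigma>_fixed[OF 2] by (simp add: polarization_iff)
    then show ?thesis by blast
  next
    case 3
    then have "\<sigma> x \<in> polarization H \<Omega>" using x by (simp add: polarization_iff H_iff)
    then show ?thesis by blast
  qed
qed

text \<open>If two points of the polarized set come from the same copy of the domain, their distance is
a distance in the domain. Otherwise both lie in \<open>H\<close> and one has moved across the line
towards the other, so their distance has only decreased.\<close>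
lemma polarization_norm_diff_le_1:
  assumes "x \<in> polarization H \<Omega>" "y \<in> polarization H \<Omega>"
  shows "norm (x - y) \<le> 1"
proof (cases "(x \<in> \<Omega> \<and> y \<in> \<Omega>) \<or> (\<sigma> x \<in> \<Omega> \<and> \<sigma> y \<in> \<Omega>)")
  case True
  then show ?thesis using norm_diff_le_1[of x y] norm_diff_le_1[of "\<sigma> x" "\<sigma> y"] norm_\<sigma>_diff[of x y] by auto
next
  case False
  then have "x \<in> H" "y \<in> H" and m: "(x \<in> \<Omega> \<and> \<sigma> y \<in> \<Omega>) \<or> (\<sigma> x \<in> \<Omega> \<and> y \<in> \<Omega>)"
    using assms unfolding polarization_iff by blast+
  then have "0 \<le> (a \<bullet> x - b) * (a \<bullet> y - b)"
    unfolding H_iff by (intro mult_nonpos_nonpos) auto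
  then have "norm (x - y) \<le> norm (x - \<sigma> y)" by (rule norm_le_reflected)
  also have "norm (x - \<sigma> y) \<le> 1"
    using m norm_diff_le_1[of x "\<sigma> y"] norm_diff_le_1[of "\<sigma> x" y] norm_\<sigma>_swap[of x y] by auto
  finally show ?thesis .
qed

sublocale polarized: log_domain "polarization H \<Omega>"
proof
  show "open (polarization H \<Omega>)" by (rule open_polarization)
  show "polarization H \<Omega> \<noteq> {}" by (rule polarization_nonempty)
  obtain x where "x \<in> polarization H \<Omega>" using polarization_nonempty by blast
  then show "bounded (polarization H \<Omega>)"
    unfolding bounded_def using polarization_norm_diff_le_1 by (auto simp: dist_norm)
  show "diameter (polarization H \<Omega>) \<le> 1"
    by (rule diameter_le) (auto intro: polarization_norm_diff_le_1)
qed

lemma bounded_density_pol: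
  assumes "bounded_density \<Omega> u"
  shows "bounded_density (polarization H \<Omega>) (pol u)"
proof -
  obtain B where B: "\<And>x. u x \<le> B" using assms by (auto simp: bounded_density_def)
  have u: "u \<in> borel_measurable borel" "\<And>x. 0 \<le> u x" "\<And>x. x \<notin> \<Omega> \<Longrightarrow> u x = 0"
    using assms by (auto simp: bounded_density_def)
  have "pol u x \<le> B" for x
    using B[of x] B[of "\<sigma> x"] by (auto simp: pol_def min_le_iff_disj)
  moreover have "pol u x = 0" if "x \<notin> polarization H \<Omega>" for x
    using that u(2)[of x] u(2)[of "\<sigma> x"] u(3)[of x] u(3)[of "\<sigma> x"]
    by (auto simp: pol_def polarization_iff)
  moreover have "0 \<le> pol u x" for x
    using u(2) by (auto simp: pol_def le_max_iff_disj)
  ultimately show ?thesis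
    using pol_measurable[OF u(1)] unfolding bounded_density_def by blast
qed

text \<open>The polarized set is obtained from \<open>\<Omega>\<close> by adding the points of \<open>gained\<close> and removing their
mirror images, and from the reflected set by doing the same with \<open>kept\<close>.\<close>
definition gained :: "(real^2) set" where "gained = {x \<in> H. x \<notin> \<Omega> \<and> \<sigma> x \<in> \<Omega>}"

definition kept :: "(real^2) set" where "kept = {x \<in> H. x \<in> \<Omega> \<and> \<sigma> x \<notin> \<Omega>}"

lemma gained_measurable [measurable]: "gained \<in> sets borel"
  and kept_measurable [measurable]: "kept \<in> sets borel"
proof -
  have [measurable]: "\<Omega> \<in> sets borel" using open_domain by simp
  show "gained \<in> sets borel" "kept \<in> sets borel"
    unfolding gained_def kept_def by measurable
qed

text \<open>A point of \<open>\<Omega>\<close> that stays in \<open>H\<close> and a point of \<open>\<Omega>\<close> that is moved into \<open>H\<close> strictly approach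
each other. The kernel increases strictly because their original distance is at most one,
where truncation has no effect.\<close>
lemma reflected_energy_density_pol_strict:
  assumes u: "bounded_density \<Omega> u" and pos: "\<And>x. x \<in> \<Omega> \<Longrightarrow> 0 < u x"
    and x: "x \<in> kept" and y: "y \<in> gained"
  shows "reflected_energy_density u x y < reflected_energy_density (pol u) x y"
proof -
  have 0: "u z = 0" if "z \<notin> \<Omega>" for z using u that by (simp add: bounded_density_def)
  have xs: "a \<bullet> x - b < 0" "x \<in> \<Omega>" "\<sigma> x \<notin> \<Omega>" and ys: "a \<bullet> y - b < 0" "y \<notin> \<Omega>" "\<sigma> y \<in> \<Omega>"
    using x y by (auto simp: kept_def gained_def H_iff)
  have "log_kernel x (\<sigma> y) < log_kernel x y"
  proof (rule log_kernel_strict_antimono)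
    show "x \<noteq> y" using xs ys by blast
    show "norm (x - y) < norm (x - \<sigma> y)"
      by (rule norm_less_reflected) (use xs ys in \<open>simp add: mult_neg_neg\<close>)
    show "norm (x - \<sigma> y) \<le> 1" using xs ys by (intro norm_diff_le_1)
  qed
  moreover have "0 < u x * u (\<sigma> y)" using pos xs ys by simp
  ultimately have "log_kernel x (\<sigma> y) * (u x * u (\<sigma> y)) < log_kernel x y * (u x * u (\<sigma> y))"
    by (rule mult_strict_right_mono)
  then show ?thesis
    using pos[OF xs(2)] pos[OF ys(3)]
    by (simp add: reflected_energy_density_def pol_neg_side[OF xs(1)] pol_neg_side[OF ys(1)] 0 xs ys max_def min_def)
qed

text \<open>If both sets had positive measure, then so would the set of pairs on which the energy
density increases strictly.\<close>
lemma kept_or_gained_null: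
  assumes u: "bounded_density \<Omega> u" and pos: "\<And>x. x \<in> \<Omega> \<Longrightarrow> 0 < u x"
    and eq: "log_energy (pol u) = log_energy u" and fin: "log_energy u < \<infinity>"
  shows "(AE x in lborel. x \<notin> kept) \<or> (AE x in lborel. x \<notin> gained)"
proof (rule disjCI)
  assume gained: "\<not> (AE x in lborel. x \<notin> gained)"
  have *: "\<exists>y\<in>gained. P y" if "AE y in lborel. P y" for P
  proof (rule ccontr)
    assume "\<not> (\<exists>y\<in>gained. P y)"
    with that have "AE y in lborel. y \<notin> gained" by (auto elim: eventually_mono)
    with gained show False by contradiction
  qed
  have "AE x in lborel. AE y in lborel. reflected_energy_density u x y = reflected_energy_density (pol u) x y"
    using u by (intro log_energy_pol_eqD eq fin) (auto simp: bounded_density_def)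
  then show "AE x in lborel. x \<notin> kept"
    by eventually_elim (use * reflected_energy_density_pol_strict[OF u pos] in force)
qed

lemma polarization_ae_eq:
  assumes "AE x in lborel. x \<notin> gained"
  shows "polarization H \<Omega> \<cong>\<^sub>a\<^sub>e \<Omega>"
proof (rule ae_eq_setI)
  show "AE x in lborel. x \<in> polarization H \<Omega> \<longleftrightarrow> x \<in> \<Omega>"
    using assms AE_\<sigma>[OF assms]
  proof eventually_elim
    case (elim x)
    then show ?case
      using side_\<sigma>[of x] \<sigma>_fixed[of x]
      by (cases "a \<bullet> x - b = 0") (auto simp: polarization_iff gained_def H_iff not_less)
  qed
qed (use open_domain open_polarization in auto)

lemma polarization_ae_eq_reflection:
  assumes "AE x in lborel. x \<notin> kept"
  shows "polarization H \<Omega> \<cong>\<^sub>a\<^sub>e reflection H ` \<Omega>"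
  unfolding reflection_eq image_\<sigma>
proof (rule ae_eq_setI)
  show "\<sigma> -` \<Omega> \<in> sets borel" by (intro borel_open open_vimage open_domain continuous_\<sigma>)
  show "AE x in lborel. x \<in> polarization H \<Omega> \<longleftrightarrow> x \<in> \<sigma> -` \<Omega>"
    using assms AE_\<sigma>[OF assms]
  proof eventually_elim
    case (elim x)
    then show ?case
      using side_\<sigma>[of x] \<sigma>_fixed[of x]
      by (cases "a \<bullet> x - b = 0") (auto simp: polarization_iff kept_def H_iff not_less)
  qed
qed (use open_polarization in auto)

lemma tau1_polarization:
  "tau1 \<Omega> \<le> tau1 (polarization H \<Omega>) \<and>
    (tau1 \<Omega> = tau1 (polarization H \<Omega>) \<longrightarrow>
      polarization H \<Omega> \<cong>\<^sub>a\<^sub>e \<Omega> \<or> polarization H \<Omega> \<cong>\<^sub>a\<^sub>e reflection H ` \<Omega>)"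
proof -
  obtain w where w: "bounded_density \<Omega> w" "\<And>x. x \<in> \<Omega> \<Longrightarrow> 0 < w x"
    and E: "log_energy w = ennreal (tau1 \<Omega>) * square_mass w"
    and m: "0 < square_mass w" "square_mass w < \<infinity>"
    by (rule positive_eigenfunction) (rule that)
  have wm: "w \<in> borel_measurable borel" "\<And>x. 0 \<le> w x" using w(1) by (auto simp: bounded_density_def)
  have ge: "log_energy w \<le> log_energy (pol w)" by (rule log_energy_pol_ge[OF wm])
  have le: "log_energy (pol w) \<le> ennreal (tau1 (polarization H \<Omega>)) * square_mass w"
    using polarized.log_energy_le_tau1[OF bounded_density_pol[OF w(1)]] by (simp add: square_mass_pol[OF wm(1)])
  have "square_mass w * ennreal (tau1 \<Omega>) \<le> square_mass w * ennreal (tau1 (polarization H \<Omega>))"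
    using order_trans[OF ge le] by (simp add: E mult.commute)
  then have "ennreal (tau1 \<Omega>) \<le> ennreal (tau1 (polarization H \<Omega>))"
    using m by (subst (asm) ennreal_mult_le_mult_iff) auto
  then have "tau1 \<Omega> \<le> tau1 (polarization H \<Omega>)"
    using top_value_pos polarized.top_value_pos
    by (simp add: tau1_eq_top_value polarized.tau1_eq_top_value)
  moreover have "polarization H \<Omega> \<cong>\<^sub>a\<^sub>e \<Omega> \<or> polarization H \<Omega> \<cong>\<^sub>a\<^sub>e reflection H ` \<Omega>"
    if "tau1 \<Omega> = tau1 (polarization H \<Omega>)"
  proof -
    have "log_energy (pol w) = log_energy w"
      using ge le unfolding E that by (rule antisym[rotated])
    moreover have "log_energy w < \<infinity>"
      unfolding E using m(2) by (simp add: ennreal_mult_less_top)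
    ultimately show ?thesis
      using kept_or_gained_null[OF w] polarization_ae_eq polarization_ae_eq_reflection by blast
  qed
  ultimately show ?thesis by blast
qed

end

section \<open>The polarization inequality\<close>
theorem corollary1p6:
  fixes \<Omega> H :: "(real^2) set"
  assumes "open \<Omega>" and "bounded \<Omega>" and "diameter \<Omega> \<le> 1"
    and "polarizer H"
  shows "tau1 \<Omega> \<le> tau1 (polarization H \<Omega>) \<and>
    (tau1 \<Omega> = tau1 (polarization H \<Omega>) \<longrightarrow>
      polarization H \<Omega> \<cong>\<^sub>a\<^sub>e \<Omega> \<or> polarization H \<Omega> \<cong>\<^sub>a\<^sub>e reflection H ` \<Omega>)"
proof (cases "\<Omega> = {}")
  case True
  then have "polarization H \<Omega> = \<Omega>" by (simp add: polarization_def)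
  then show ?thesis by (simp add: ae_eq_set_def)
next
  case False
  obtain a b where ab: "a \<noteq> 0" "H = {x. a \<bullet> x < b}" using assms(4) by (auto simp: polarizer_def)
  interpret polarized_domain a b \<Omega>
    by unfold_locales (use assms False ab in auto)
  show ?thesis using tau1_polarization by (simp add: H_def ab(2))
qed

end
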